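(* The following assertions hold: (i) An arbitrary product of $\kappa$-spaces is a $\kappa$-space. (ii) A closed subspace of a $\kappa$-space is a $\kappa$-space. (iii) Each realcompact space is a $\kappa$-space. (iv) If $\mathcal{M}$ is a nonempty family of subspaces of a Tychonoff space $X$ each of which is a $\kappa$-space, then $\bigcap\mathcal{M}$ is a $\kappa$-space. (v) If $X$, $Y$ are Tychonoff spaces, $f:X\to Y$ is a perfect mapping and $Y$ is a $\kappa$-space, then $X$ is also a $\kappa$-space. (vi) If $X$ is a Tychonoff space such that $C_p(X)$ is a $k_{\mathbb{R}}$-space, then $X$ is a $\kappa$-space. (vii) Each $\kappa$-space is a $\mu$-space. (viii) Each metrizable space is a $\kappa$-space. (ix) Each Dieudonné complete space is a $\kappa$-space. (x) A pseudocompact space is a $\kappa$-space if, and only if, it is compact. Consequently, the first countable pseudocompact space $\omega_1$ is not a $\kappa$-space. (xi) If $X$ is a $k_{\mathbb{R}}$-space, then $C_p(X)$ is a $\kappa$-space.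
   Context: All spaces are Tychonoff. $C_p(Y)$ is the set $C(Y)$ of all continuous real-valued functions on $Y$ with the topology of pointwise convergence. A Tychonoff space is called a $\kappa$-space if it is homeomorphic to a closed subspace of $C_p(Y)$ for some locally compact (Hausdorff) space $Y$. A Tychonoff space $X$ is a $k_{\mathbb{R}}$-space if every function $f:X\to\mathbb{R}$ whose restriction to each compact subset of $X$ is continuous is itself continuous. A subset $A\subseteq X$ is functionally bounded if $f(A)$ is bounded in $\mathbb{R}$ for every $f\in C(X)$; $X$ is a $\mu$-space if every functionally bounded subset of $X$ has compact closure. A space is Dieudonné complete if it admits a complete compatible uniformity (equivalently, it is homeomorphic to a closed subspace of a product of metrizable spaces). A space is pseudocompact if every continuous real-valued function on it is bounded. A perfect mapping is a continuous closed mapping with compact fibers. $\omega_1$ carries the order topology. *)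

theory Defs
  imports "HOL-Analysis.Analysis" "HOL-Library.Countable_Set_Type"
begin

definition Tychonoff_space :: "'a topology \<Rightarrow> bool" where
  "Tychonoff_space X \<longleftrightarrow> completely_regular_space X \<and> Hausdorff_space X"

text \<open>As a point of the product \<^term>\<open>powertop_real (topspace Y)\<close>, a function on \<^term>\<open>Y\<close> takes the
  value \<^term>\<open>undefined\<close> outside \<^term>\<open>topspace Y\<close>; so each continuous function on the space is
  represented exactly once.\<close>

definition Cp :: "'a topology \<Rightarrow> ('a \<Rightarrow> real) topology" where
  "Cp Y = subtopology (powertop_real (topspace Y)) {f. continuous_map Y euclideanreal f}"

text \<open>HOL cannot quantify existentially over the type of points of \<open>Y\<close>, so a type
  determined by that of \<open>X\<close> is fixed.  This is no restriction: by \<open>kappa_spaceI\<close> below, a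
  locally compact Hausdorff space over any type whatever may serve as a witness.\<close>

definition kappa_space :: "'a topology \<Rightarrow> bool" where
  "kappa_space X \<longleftrightarrow> Tychonoff_space X \<and>
    (\<exists>(Y :: (('a \<Rightarrow> real) set \<times> ('a \<Rightarrow> real)) topology) C.
        locally_compact_space Y \<and> Hausdorff_space Y \<and> closedin (Cp Y) C \<and>
        X homeomorphic_space subtopology (Cp Y) C)"

text \<open>The standard definition by closed subspaces of powers of the real line.  Again the type of the
  exponent is immaterial, by \<open>realcompact_spaceI\<close> below.\<close>

definition realcompact_space :: "'a topology \<Rightarrow> bool" where
  "realcompact_space X \<longleftrightarrow>
    (\<exists>(I :: ('a \<Rightarrow> real) set) C. closedin (powertop_real I) C \<and>
        X homeomorphic_space subtopology (powertop_real I) C)"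

definition kR_space :: "'a topology \<Rightarrow> bool" where
  "kR_space X \<longleftrightarrow> Tychonoff_space X \<and>
    (\<forall>f :: 'a \<Rightarrow> real.
       (\<forall>K. compactin X K \<longrightarrow> continuous_map (subtopology X K) euclideanreal f) \<longrightarrow>
       continuous_map X euclideanreal f)"

definition functionally_bounded_in :: "'a topology \<Rightarrow> 'a set \<Rightarrow> bool" where
  "functionally_bounded_in X A \<longleftrightarrow> A \<subseteq> topspace X \<and>
    (\<forall>f :: 'a \<Rightarrow> real. continuous_map X euclideanreal f \<longrightarrow> bounded (f ` A))"

definition mu_space :: "'a topology \<Rightarrow> bool" where
  "mu_space X \<longleftrightarrow> Tychonoff_space X \<and>
    (\<forall>A. functionally_bounded_in X A \<longrightarrow> compactin X (X closure_of A))"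

definition pseudocompact_space :: "'a topology \<Rightarrow> bool" where
  "pseudocompact_space X \<longleftrightarrow> Tychonoff_space X \<and>
    (\<forall>f :: 'a \<Rightarrow> real. continuous_map X euclideanreal f \<longrightarrow> bounded (f ` topspace X))"

text \<open>Uniformities on a set \<open>S\<close>, as filters of entourages; the axioms are those of the
  class \<^class>\<open>uniform_space\<close>, relativised to \<open>S\<close>.\<close>

definition uniformity_on :: "'a set \<Rightarrow> ('a \<times> 'a) filter \<Rightarrow> bool" where
  "uniformity_on S \<Phi> \<longleftrightarrow>
    eventually (\<lambda>p. p \<in> S \<times> S) \<Phi> \<and>
    (\<forall>E. eventually E \<Phi> \<longrightarrow>
        (\<forall>x\<in>S. E (x, x)) \<and>
        eventually (\<lambda>(x, y). E (y, x)) \<Phi> \<and>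
        (\<exists>D. eventually D \<Phi> \<and> (\<forall>x y z. D (x, y) \<longrightarrow> D (y, z) \<longrightarrow> E (x, z))))"

definition compatible_uniformity :: "'a topology \<Rightarrow> ('a \<times> 'a) filter \<Rightarrow> bool" where
  "compatible_uniformity X \<Phi> \<longleftrightarrow>
    uniformity_on (topspace X) \<Phi> \<and>
    (\<forall>U. openin X U \<longleftrightarrow>
        U \<subseteq> topspace X \<and> (\<forall>x\<in>U. eventually (\<lambda>(x', y). x' = x \<longrightarrow> y \<in> U) \<Phi>))"

definition Dieudonne_complete_space :: "'a topology \<Rightarrow> bool" where
  "Dieudonne_complete_space X \<longleftrightarrow> Tychonoff_space X \<and>
    (\<exists>\<Phi>. compatible_uniformity X \<Phi> \<and>
        (\<forall>F. F \<noteq> bot \<longrightarrow> F \<times>\<^sub>F F \<le> \<Phi> \<longrightarrow> (\<exists>l. limitin X (\<lambda>x. x) l F)))"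

text \<open>The interval topology of a linear order given as a relation: the open rays form a subbase.\<close>

definition order_topology_of :: "'a rel \<Rightarrow> 'a topology" where
  "order_topology_of r = topology_generated_by
     ({Field r} \<union> {underS r a | a. a \<in> Field r} \<union> {aboveS r a | a. a \<in> Field r})"

text \<open>\<^term>\<open>cardSuc natLeq\<close> is an initial well-ordering of the least uncountable cardinality.\<close>

definition omega1 :: "nat set topology" where
  "omega1 = order_topology_of (cardSuc natLeq)"


subsection \<open>Adequacy of the definitions\<close>

lemma topspace_omega1: "topspace omega1 = Field (cardSuc natLeq)"
  by (auto simp: omega1_def order_topology_of_def topology_generated_by_topspace
      underS_def aboveS_def Field_def)

lemma omega1_order:
  includes cardinal_syntax
  shows "Well_order (cardSuc natLeq)"
    and "uncountable (Field (cardSuc natLeq))"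
    and "\<And>a. countable (underS (cardSuc natLeq) a)"
proof -
  have C: "Card_order (cardSuc natLeq)"
    by (simp add: cardSuc_Card_order natLeq_Card_order)
  show "Well_order (cardSuc natLeq)"
    using C card_order_on_well_order_on by blast
  have *: "natLeq <o cardSuc natLeq"
    by (simp add: cardSuc_greater natLeq_Card_order)
  show "uncountable (Field (cardSuc natLeq))"
  proof
    assume "countable (Field (cardSuc natLeq))"
    then have "cardSuc natLeq \<le>o natLeq"
      using C by (metis card_of_Field_ordIso countable_card_le_natLeq ordIso_ordLeq_trans ordIso_symmetric)
    then show False
      using * not_ordLess_ordLeq by blast
  qed
  show "countable (underS (cardSuc natLeq) a)" for a
  proof (cases "a \<in> Field (cardSuc natLeq)")
    case True
    then have "|underS (cardSuc natLeq) a| <o cardSuc natLeq"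
      by (rule card_of_underS[OF C])
    then show ?thesis
      using cardSuc_ordLeq_ordLess[OF natLeq_Card_order card_of_Card_order,
          of "underS (cardSuc natLeq) a"]
      by (simp add: countable_card_le_natLeq)
  next
    case False
    then have "underS (cardSuc natLeq) a = {}"
      by (auto simp: underS_def Field_def)
    then show ?thesis by simp
  qed
qed

lemma realcompact_spaceI:
  fixes X :: "'a topology" and I :: "'i set"
  assumes C: "closedin (powertop_real I) C"
    and hom: "X homeomorphic_space subtopology (powertop_real I) C"
  shows "realcompact_space X"
proof -
  obtain h g where hg: "homeomorphic_maps X (subtopology (powertop_real I) C) h g"
    using hom homeomorphic_space_def by blast
  define e where "e = (\<lambda>i. restrict (\<lambda>x. h x i) (topspace X))"
  define J where "J = e ` I"
  define \<phi> where "\<phi> = (\<lambda>x. restrict (\<lambda>j. j x) J)"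
  define \<rho> where "\<rho> = (\<lambda>f :: ('a \<Rightarrow> real) \<Rightarrow> real. restrict (\<lambda>i. f (e i)) I)"
  define D where "D = {f \<in> topspace (powertop_real J). \<rho> f \<in> C}"
  have h: "continuous_map X (powertop_real I) h" and hC: "\<And>x. x \<in> topspace X \<Longrightarrow> h x \<in> C"
    and g: "continuous_map (subtopology (powertop_real I) C) X g"
    and gh: "\<And>x. x \<in> topspace X \<Longrightarrow> g (h x) = x"
    and hg': "\<And>f. f \<in> C \<Longrightarrow> h (g f) = f"
    using hg closedin_subset[OF C] by (auto simp: homeomorphic_maps_def continuous_map_in_subtopology)
  have gC: "\<And>f. f \<in> C \<Longrightarrow> g f \<in> topspace X"
    using g closedin_subset[OF C] by (fastforce simp: continuous_map_def)
  have hi: "continuous_map X euclideanreal (\<lambda>x. h x i)" if "i \<in> I" for i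
    using h that by (simp add: continuous_map_componentwise)
  have hext: "h x \<in> extensional I" if "x \<in> topspace X" for x
    using h that by (auto simp: continuous_map_componentwise)
  have \<rho>: "continuous_map (powertop_real J) (powertop_real I) \<rho>"
    unfolding continuous_map_componentwise
    by (auto simp: \<rho>_def J_def intro!: continuous_map_product_projection)
  have D: "closedin (powertop_real J) D"
    unfolding D_def by (rule closedin_continuous_map_preimage[OF \<rho> C])
  have \<phi>cont: "continuous_map X (powertop_real J) \<phi>"
    unfolding continuous_map_componentwise
  proof (intro conjI ballI)
    show "\<phi> ` topspace X \<subseteq> extensional J" by (auto simp: \<phi>_def)
    fix j assume j: "j \<in> J"
    then obtain i where i: "i \<in> I" "j = e i" by (auto simp: J_def)
    show "continuous_map X euclideanreal (\<lambda>x. \<phi> x j)"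
      using hi[OF i(1)] by (rule continuous_map_eq) (use i j in \<open>auto simp: \<phi>_def e_def\<close>)
  qed
  have \<rho>\<phi>: "\<rho> (\<phi> x) = h x" if "x \<in> topspace X" for x
    using hext[OF that] that
    by (auto simp: \<rho>_def \<phi>_def J_def e_def fun_eq_iff extensional_def)
  have "homeomorphic_maps X (subtopology (powertop_real J) D) \<phi> (g \<circ> \<rho>)"
    unfolding homeomorphic_maps_def
  proof (intro conjI ballI)
    show "continuous_map X (subtopology (powertop_real J) D) \<phi>"
    proof -
      have "\<phi> x \<in> D" if "x \<in> topspace X" for x
        using continuous_map_image_subset_topspace[OF \<phi>cont] hC[OF that] that
        by (auto simp: D_def \<rho>\<phi>[OF that] simp del: topspace_product_topology)
      then show ?thesis
        using \<phi>cont by (simp add: continuous_map_in_subtopology)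
    qed
    show "continuous_map (subtopology (powertop_real J) D) X (g \<circ> \<rho>)"
    proof (rule continuous_map_compose[OF _ g])
      show "continuous_map (subtopology (powertop_real J) D) (subtopology (powertop_real I) C) \<rho>"
        using \<rho> by (auto simp: continuous_map_in_subtopology D_def intro: continuous_map_from_subtopology)
    qed
    show "(g \<circ> \<rho>) (\<phi> x) = x" if "x \<in> topspace X" for x
      using that by (simp add: \<rho>\<phi> gh)
    show "\<phi> ((g \<circ> \<rho>) f) = f" if "f \<in> topspace (subtopology (powertop_real J) D)" for f
    proof
      fix j
      from that have f: "f \<in> extensional J" "\<rho> f \<in> C" by (auto simp: D_def PiE_def)
      show "\<phi> ((g \<circ> \<rho>) f) j = f j"
      proof (cases "j \<in> J")
        case True
        then obtain i where i: "i \<in> I" "j = e i" by (auto simp: J_def)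
        have "\<phi> ((g \<circ> \<rho>) f) j = e i (g (\<rho> f))"
          using True i by (simp add: \<phi>_def)
        also have "\<dots> = \<rho> f i"
          using gC[OF f(2)] hg'[OF f(2)] by (simp add: e_def)
        also have "\<dots> = f j"
          using i by (simp add: \<rho>_def)
        finally show ?thesis .
      qed (use f in \<open>auto simp: \<phi>_def extensional_def\<close>)
    qed
  qed
  then have "X homeomorphic_space subtopology (powertop_real J) D"
    unfolding homeomorphic_space_def by (intro exI)
  with D show ?thesis
    unfolding realcompact_space_def by (intro exI conjI)
qed

text \<open>The witness over the fixed type is the disjoint sum of the images of the compact subsets
  of \<open>Y\<close> under the evaluation map from \<open>Y\<close> into the power of the real line indexed by \<open>X\<close>.\<close>

lemma kappa_spaceI:
  fixes X :: "'a topology" and Y :: "'b topology"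
  assumes tych: "Tychonoff_space X"
    and lc: "locally_compact_space Y" and "Hausdorff_space Y"
    and C: "closedin (Cp Y) C"
    and hom: "X homeomorphic_space subtopology (Cp Y) C"
  shows "kappa_space X"
proof -
  obtain h g where hg: "homeomorphic_maps X (subtopology (Cp Y) C) h g"
    using hom homeomorphic_space_def by blast
  have CCp: "f \<in> extensional (topspace Y)" "continuous_map Y euclideanreal f" if "f \<in> C" for f
    using that closedin_subset[OF C] by (auto simp: Cp_def PiE_def)
  have h': "continuous_map X (Cp Y) h" and hC: "\<And>x. x \<in> topspace X \<Longrightarrow> h x \<in> C"
    and g: "continuous_map (subtopology (Cp Y) C) X g"
    and gh: "\<And>x. x \<in> topspace X \<Longrightarrow> g (h x) = x"
    and hg': "\<And>f. f \<in> C \<Longrightarrow> h (g f) = f"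
    using hg closedin_subset[OF C] by (auto simp: homeomorphic_maps_def continuous_map_in_subtopology)
  have h: "continuous_map X (powertop_real (topspace Y)) h"
    using h' by (simp add: Cp_def continuous_map_in_subtopology)
  have gC: "\<And>f. f \<in> C \<Longrightarrow> g f \<in> topspace X"
    using g closedin_subset[OF C] by (fastforce simp: continuous_map_def)
  have hi: "continuous_map X euclideanreal (\<lambda>x. h x y)" if "y \<in> topspace Y" for y
    using h that by (simp add: continuous_map_componentwise)

  define R where "R = powertop_real (topspace X)"
  define e where "e = (\<lambda>y. restrict (\<lambda>x. h x y) (topspace X))"
  have e: "continuous_map Y R e"
    unfolding R_def continuous_map_componentwise
    by (auto simp: e_def CCp(2) hC)
  define \<K> where "\<K> = {e ` K | K. compactin Y K}"
  have \<K>: "compactin R L" if "L \<in> \<K>" for L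
    using that e image_compactin by (auto simp: \<K>_def)
  define Z where "Z = sum_topology (\<lambda>L. subtopology R L) \<K>"
  have topZ: "(L, z) \<in> topspace Z \<longleftrightarrow> L \<in> \<K> \<and> z \<in> L" for L z
    using \<K> compactin_subset_topspace by (fastforce simp: Z_def)
  have HR: "Hausdorff_space R"
    by (simp add: R_def Hausdorff_space_product_topology)
  have lcZ: "locally_compact_space Z"
    unfolding Z_def locally_compact_space_sum_topology
    by (auto intro!: compact_imp_locally_compact_space compact_space_subtopology \<K>)
  have HZ: "Hausdorff_space Z"
    unfolding Hausdorff_space_def
  proof (intro strip, elim conjE)
    fix p q assume p: "p \<in> topspace Z" and q: "q \<in> topspace Z" and ne: "p \<noteq> q"
    obtain L z M w where pq: "p = (L, z)" "q = (M, w)" by fastforce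
    show "\<exists>U V. openin Z U \<and> openin Z V \<and> p \<in> U \<and> q \<in> V \<and> disjnt U V"
    proof (cases "L = M")
      case False
      have op: "openin Z (Pair N ` topspace (subtopology R N))" if "N \<in> \<K>" for N
        using open_map_component_injection[OF that, of "\<lambda>L. subtopology R L"]
        unfolding Z_def open_map_def by blast
      show ?thesis
        apply (rule exI[of _ "Pair L ` topspace (subtopology R L)"])
        apply (rule exI[of _ "Pair M ` topspace (subtopology R M)"])
        using p q op False unfolding pq by (auto simp: Z_def disjnt_def)
    next
      case True
      then have zw: "z \<noteq> w" "L \<in> \<K>" "z \<in> topspace (subtopology R L)" "w \<in> topspace (subtopology R L)"
        using p q ne by (auto simp: pq Z_def)
      have "Hausdorff_space (subtopology R L)"
        by (simp add: HR Hausdorff_space_subtopology)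
      then obtain U V where UV: "openin (subtopology R L) U" "openin (subtopology R L) V"
        "z \<in> U" "w \<in> V" "disjnt U V"
        using zw unfolding Hausdorff_space_def by meson
      have op: "openin Z (Pair L ` W)" if "openin (subtopology R L) W" for W
        using open_map_component_injection[OF zw(2), of "\<lambda>L. subtopology R L"] that
        unfolding Z_def open_map_def by blast
      show ?thesis
        apply (rule exI[of _ "Pair L ` U"])
        apply (rule exI[of _ "Pair L ` V"])
        using UV op True unfolding pq by (auto simp: disjnt_def)
    qed
  qed
  have contZ: "continuous_map Z euclideanreal f \<longleftrightarrow>
        (\<forall>L\<in>\<K>. continuous_map (subtopology R L) euclideanreal (\<lambda>z. f (L, z)))" for f
  proof
    assume f: "continuous_map Z euclideanreal f"
    show "\<forall>L\<in>\<K>. continuous_map (subtopology R L) euclideanreal (\<lambda>z. f (L, z))"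
    proof
      fix L assume "L \<in> \<K>"
      then have "continuous_map (subtopology R L) Z (\<lambda>z. (L, z))"
        unfolding Z_def by (rule continuous_map_component_injection)
      from continuous_map_compose[OF this f]
      show "continuous_map (subtopology R L) euclideanreal (\<lambda>z. f (L, z))" by (simp add: o_def)
    qed
  next
    assume r: "\<forall>L\<in>\<K>. continuous_map (subtopology R L) euclideanreal (\<lambda>z. f (L, z))"
    show "continuous_map Z euclideanreal f"
      unfolding continuous_map_def
    proof (intro conjI strip)
      fix U :: "real set" assume U: "openin euclideanreal U"
      show "openin Z {x \<in> topspace Z. f x \<in> U}"
        unfolding Z_def openin_sum_topology
      proof (intro conjI ballI)
        fix L assume L: "L \<in> \<K>"
        have "openin (subtopology R L) {z \<in> topspace (subtopology R L). f (L, z) \<in> U}"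
          using r L U openin_continuous_map_preimage by blast
        moreover have "{x. (L, x) \<in> {x \<in> topspace (sum_topology (subtopology R) \<K>). f x \<in> U}} =
            {z \<in> topspace (subtopology R L). f (L, z) \<in> U}"
          using L by auto
        ultimately show "openin (subtopology R L)
            {x. (L, x) \<in> {x \<in> topspace (sum_topology (subtopology R) \<K>). f x \<in> U}}"
          by simp
      qed auto
    qed auto
  qed

  have sing: "{e y} \<in> \<K>" if "y \<in> topspace Y" for y
    unfolding \<K>_def using that by (auto intro!: exI[of _ "{y}"])
  have singZ: "({e y}, e y) \<in> topspace Z" if "y \<in> topspace Y" for y
    using sing[OF that] by (simp add: topZ)
  have Zrep: "\<exists>y\<in>topspace Y. z = e y \<and> {z} \<in> \<K>" if "(L, z) \<in> topspace Z" for L z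
  proof -
    from that obtain K where K: "compactin Y K" "z \<in> e ` K" by (auto simp: topZ \<K>_def)
    then obtain y where "y \<in> topspace Y" "z = e y" using compactin_subset_topspace by blast
    then show ?thesis using sing by blast
  qed

  define \<phi> where "\<phi> = (\<lambda>x. restrict (\<lambda>p. snd p x) (topspace Z))"
  define \<rho> where "\<rho> = (\<lambda>f. restrict (\<lambda>y. f ({e y}, e y)) (topspace Y) :: 'b \<Rightarrow> real)"
  define E where "E = {f \<in> topspace (Cp Z). \<forall>p\<in>topspace Z. f p - f ({snd p}, snd p) = 0}"
  define D where "D = {f \<in> E. \<rho> f \<in> C}"

  have proj: "continuous_map (Cp Z) euclideanreal (\<lambda>f. f p)" if "p \<in> topspace Z" for p
    unfolding Cp_def using that
    by (intro continuous_map_from_subtopology continuous_map_product_projection)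
  have E: "closedin (Cp Z) E"
  proof -
    have 1: "closedin (Cp Z) {f \<in> topspace (Cp Z). f p - f ({snd p}, snd p) \<in> {0}}"
      if "p \<in> topspace Z" for p
    proof -
      obtain L z where p: "p = (L, z)" by fastforce
      have "({snd p}, snd p) \<in> topspace Z"
        using Zrep[of L z] that p by (auto simp: topZ)
      then have "continuous_map (Cp Z) euclideanreal (\<lambda>f. f p - f ({snd p}, snd p))"
        using proj that by (intro continuous_map_diff) auto
      then show ?thesis
        by (rule closedin_continuous_map_preimage) simp
    qed
    have "E = topspace (Cp Z) \<inter>
        (\<Inter>p\<in>topspace Z. {f \<in> topspace (Cp Z). f p - f ({snd p}, snd p) \<in> {0}})"
      by (auto simp: E_def)
    also have "closedin (Cp Z) \<dots>"
    proof (cases "topspace Z = {}")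
      case False
      then show ?thesis
        by (intro closedin_Int closedin_Inter closedin_topspace) (use 1 in auto)
    qed simp
    finally show ?thesis .
  qed
  have Eval: "f (L, z) = f ({z}, z)" if "f \<in> E" "(L, z) \<in> topspace Z" for f L z
    using that by (force simp: E_def)
  have \<rho>E: "continuous_map Y euclideanreal (\<rho> f)" if f: "f \<in> E" for f
  proof -
    have fc: "continuous_map Z euclideanreal f"
      using f by (auto simp: E_def Cp_def)
    have loc: "\<exists>U. openin Y U \<and> y \<in> U \<and> continuous_map (subtopology Y U) euclideanreal (\<rho> f)"
      if "y \<in> topspace Y" for y
    proof -
      obtain U K where U: "openin Y U" "compactin Y K" "y \<in> U" "U \<subseteq> K"
        using lc \<open>y \<in> topspace Y\<close> unfolding locally_compact_space_def by meson
      define L where "L = e ` K"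
      have L: "L \<in> \<K>" using U by (auto simp: L_def \<K>_def)
      have 1: "continuous_map (subtopology Y U) (subtopology R L) e"
        using e U by (auto simp: continuous_map_in_subtopology L_def
            intro: continuous_map_from_subtopology)
      have 2: "continuous_map (subtopology R L) euclideanreal (\<lambda>z. f (L, z))"
        using fc L contZ by blast
      have "continuous_map (subtopology Y U) euclideanreal (\<lambda>y. f (L, e y))"
        using continuous_map_compose[OF 1 2] by (simp add: o_def)
      then have "continuous_map (subtopology Y U) euclideanreal (\<rho> f)"
      proof (rule continuous_map_eq)
        fix u assume u: "u \<in> topspace (subtopology Y U)"
        then have "(L, e u) \<in> topspace Z" using L U by (auto simp: topZ L_def)
        then show "f (L, e u) = \<rho> f u"
          using u Eval[OF f] by (simp add: \<rho>_def)
      qed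
      then show ?thesis using U by blast
    qed
    show ?thesis
      by (rule pasting_lemma[of "{U. openin Y U \<and> continuous_map (subtopology Y U) euclideanreal (\<rho> f)}"
            Y "\<lambda>U. U" _ "\<lambda>_. \<rho> f"]) (use loc in auto)
  qed
  have \<rho>cont: "continuous_map (subtopology (Cp Z) E) (Cp Y) \<rho>"
    unfolding Cp_def[of Y] continuous_map_in_subtopology continuous_map_componentwise
  proof (intro conjI ballI)
    show "\<rho> ` topspace (subtopology (Cp Z) E) \<subseteq> extensional (topspace Y)"
      by (auto simp: \<rho>_def)
    show "continuous_map (subtopology (Cp Z) E) euclideanreal (\<lambda>f. \<rho> f y)"
      if "y \<in> topspace Y" for y
      using that by (simp add: \<rho>_def proj singZ continuous_map_from_subtopology)
    show "\<rho> \<in> topspace (subtopology (Cp Z) E) \<rightarrow> {f. continuous_map Y euclideanreal f}"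
      using \<rho>E by auto
  qed
  have D: "closedin (Cp Z) D"
  proof -
    have "D = {f \<in> topspace (subtopology (Cp Z) E). \<rho> f \<in> C}"
      using closedin_subset[OF E] by (auto simp: D_def)
    then have "closedin (subtopology (Cp Z) E) D"
      using closedin_continuous_map_preimage[OF \<rho>cont C] by simp
    then show ?thesis using E closedin_trans_full by blast
  qed
  have \<phi>E: "\<phi> x \<in> E" if x: "x \<in> topspace X" for x
  proof -
    have c: "continuous_map (subtopology R L) euclideanreal (\<lambda>z. \<phi> x (L, z))" if L: "L \<in> \<K>" for L
    proof -
      have "continuous_map (subtopology R L) euclideanreal (\<lambda>z. z x)"
        unfolding R_def using x
        by (intro continuous_map_from_subtopology continuous_map_product_projection)
      then show ?thesis
        by (rule continuous_map_eq) (use L in \<open>auto simp: \<phi>_def topZ\<close>)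
    qed
    then have "continuous_map Z euclideanreal (\<phi> x)"
      by (simp add: contZ)
    then have 1: "\<phi> x \<in> topspace (Cp Z)"
      by (auto simp: Cp_def \<phi>_def)
    have 2: "\<phi> x (L, z) - \<phi> x ({z}, z) = 0" if "(L, z) \<in> topspace Z" for L z
      using Zrep[OF that] that by (auto simp: \<phi>_def topZ)
    show ?thesis
      unfolding E_def using 1 2 by force
  qed
  have \<rho>\<phi>: "\<rho> (\<phi> x) = h x" if x: "x \<in> topspace X" for x
  proof
    fix y show "\<rho> (\<phi> x) y = h x y"
    proof (cases "y \<in> topspace Y")
      case True
      then show ?thesis using x singZ[OF True] by (simp add: \<rho>_def \<phi>_def) (simp add: e_def)
    next
      case False
      then show ?thesis using CCp(1)[OF hC[OF x]] by (simp add: \<rho>_def extensional_def)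
    qed
  qed
  have \<phi>cont: "continuous_map X (Cp Z) \<phi>"
    unfolding Cp_def continuous_map_in_subtopology continuous_map_componentwise
  proof (intro conjI ballI)
    show "\<phi> ` topspace X \<subseteq> extensional (topspace Z)" by (auto simp: \<phi>_def)
    show "\<phi> \<in> topspace X \<rightarrow> {f. continuous_map Z euclideanreal f}"
      using \<phi>E by (auto simp: E_def Cp_def)
    fix p assume p: "p \<in> topspace Z"
    obtain L z where Lz: "p = (L, z)" by fastforce
    obtain y where y: "y \<in> topspace Y" "z = e y" using Zrep p Lz by blast
    show "continuous_map X euclideanreal (\<lambda>x. \<phi> x p)"
      using hi[OF y(1)] by (rule continuous_map_eq) (use p Lz y in \<open>auto simp: \<phi>_def e_def\<close>)
  qed
  have "homeomorphic_maps X (subtopology (Cp Z) D) \<phi> (g \<circ> \<rho>)"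
    unfolding homeomorphic_maps_def
  proof (intro conjI ballI)
    show "continuous_map X (subtopology (Cp Z) D) \<phi>"
      using \<phi>cont hC \<phi>E by (auto simp: continuous_map_in_subtopology D_def \<rho>\<phi>)
    show "continuous_map (subtopology (Cp Z) D) X (g \<circ> \<rho>)"
    proof (rule continuous_map_compose[OF _ g])
      have "continuous_map (subtopology (Cp Z) D) (Cp Y) \<rho>"
        using \<rho>cont by (rule continuous_map_from_subtopology_mono) (auto simp: D_def)
      then show "continuous_map (subtopology (Cp Z) D) (subtopology (Cp Y) C) \<rho>"
        by (auto simp: continuous_map_in_subtopology D_def)
    qed
    show "(g \<circ> \<rho>) (\<phi> x) = x" if "x \<in> topspace X" for x
      using that by (simp add: \<rho>\<phi> gh)
    show "\<phi> ((g \<circ> \<rho>) f) = f" if "f \<in> topspace (subtopology (Cp Z) D)" for f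
    proof
      fix p
      from that have f: "f \<in> extensional (topspace Z)" "\<rho> f \<in> C" "f \<in> E"
        by (auto simp: D_def Cp_def PiE_def)
      show "\<phi> ((g \<circ> \<rho>) f) p = f p"
      proof (cases "p \<in> topspace Z")
        case True
        obtain L z where Lz: "p = (L, z)" by fastforce
        obtain y where y: "y \<in> topspace Y" "z = e y" using Zrep True Lz by blast
        have "\<phi> ((g \<circ> \<rho>) f) p = e y (g (\<rho> f))"
          using True Lz y by (simp add: \<phi>_def)
        also have "\<dots> = \<rho> f y"
          using gC[OF f(2)] hg'[OF f(2)] by (simp add: e_def)
        also have "\<dots> = f p"
          using Eval[OF f(3), of L z] True Lz y by (simp add: \<rho>_def)
        finally show ?thesis .
      qed (simp add: \<phi>_def extensional_arb[OF f(1)])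
    qed
  qed
  then have "X homeomorphic_space subtopology (Cp Z) D"
    unfolding homeomorphic_space_def by (intro exI)
  with D lcZ HZ tych show ?thesis
    unfolding kappa_space_def by (intro exI conjI)
qed

end

theory Submission
  imports Defs
begin

text \<open>A space \<open>X\<close> is a \<open>\<kappa>\<close>-space exactly when certain filters converge in it, and each of the assertions
  is easily read off from this criterion.  Let \<open>F\<close> be a proper filter on \<open>X\<close> along which every continuous
  real function \<open>f\<close> converges, and regard the limit \<open>\<lambda>(f) = Lim F f\<close> as a function on \<open>C\<^sub>p(X)\<close>.  Call \<open>F\<close>
  \<open>\<kappa>\<close>-Cauchy if \<open>\<lambda>\<close> is continuous on each compact subset of \<open>C\<^sub>p(X)\<close>, and call \<open>X\<close> \<open>\<kappa>\<close>-complete if every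
  such \<open>F\<close> converges in \<open>X\<close>.

  By \<open>kappa_space_iff\<close>, a Tychonoff space is a \<open>\<kappa>\<close>-space if and only if it is \<open>\<kappa>\<close>-complete.  If \<open>Y\<close> is a
  space on which continuity of real functions can be tested on compact sets, and \<open>F\<close> is \<open>\<kappa>\<close>-Cauchy on
  \<open>C\<^sub>p(Y)\<close>, then the pointwise limit of \<open>F\<close> is continuous on the compact subsets of \<open>Y\<close>, because these
  are mapped continuously onto compact sets of evaluations; so \<open>C\<^sub>p(Y)\<close> is \<open>\<kappa>\<close>-complete, and
  so are its closed subspaces.  Conversely, let \<open>Z\<close> be the disjoint sum of the compact subsets of
  \<open>C\<^sub>p(X)\<close>, a locally compact space.  Evaluation embeds \<open>X\<close> in \<open>C\<^sub>p(Z)\<close>, and a filter on \<open>X\<close> that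
  converges in \<open>C\<^sub>p(Z)\<close> is precisely a \<open>\<kappa>\<close>-Cauchy one; so the image is closed if \<open>X\<close> is \<open>\<kappa>\<close>-complete.

  The image of a \<open>\<kappa>\<close>-Cauchy filter under a continuous map is \<open>\<kappa>\<close>-Cauchy, and a cluster point of a
  \<open>\<kappa>\<close>-Cauchy filter is a limit.  This settles products, closed subspaces, intersections,
  perfect preimages, and, since the real line is \<open>\<kappa>\<close>-complete, realcompact spaces.  The other
  assertions rest on the following observations about a \<open>\<kappa>\<close>-Cauchy filter \<open>F\<close>.

  If \<open>C\<^sub>p(X)\<close> is a \<open>k\<^sub>\<real>\<close>-space then \<open>\<lambda>\<close> is continuous on all of \<open>C\<^sub>p(X)\<close>; if \<open>F\<close> had no cluster point,
  each finite set \<open>A\<close> would admit a function that vanishes on \<open>A\<close> and is \<open>1\<close> along \<open>F\<close>, and these functions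
  tend to \<open>0\<close> in \<open>C\<^sub>p(X)\<close> although \<open>\<lambda>\<close> is \<open>1\<close> at each of them.

  If \<open>d\<close> is a continuous pseudometric on \<open>X\<close>, then the functions into the unit interval that are \<open>1\<close>-Lipschitz
  for \<open>d\<close> form a compact subset of \<open>C\<^sub>p(X)\<close>.  Truncated distances to finite sets lie in it and tend to \<open>0\<close>, so
  \<open>F\<close> contains \<open>d\<close>-balls of arbitrarily small radius.  In a metric space \<open>F\<close> is therefore Cauchy, and the
  distance to its would-be limit is a continuous function tending to \<open>0\<close> along \<open>F\<close>, which must have a
  zero since its reciprocal would have no limit.  In a Dieudonne complete space every
  entourage contains one given by a continuous pseudometric, so that \<open>F\<close> is Cauchy for the uniformity.

  For a functionally bounded set \<open>A\<close>, every filter on \<open>A\<close> along which all continuous functions converge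
  is \<open>\<kappa>\<close>-Cauchy, by a double limit argument in the manner of Grothendieck
  (\<open>functionally_bounded_Lim_continuous\<close>).  Since the continuous functions map \<open>A\<close> into a product of compact
  intervals, \<open>\<kappa>\<close>-completeness makes the closure of \<open>A\<close> compact.  Finally, in the first uncountable ordinal
  every countable set is bounded and every initial segment \<open>[0, a]\<close> is compact, so it is pseudocompact but
  not compact.\<close>

section \<open>Tychonoff spaces and the topology of pointwise convergence\<close>

lemma Tychonoff_imp_completely_regular_space: "Tychonoff_space X \<Longrightarrow> completely_regular_space X"
  and Tychonoff_imp_Hausdorff_space: "Tychonoff_space X \<Longrightarrow> Hausdorff_space X"
  by (simp_all add: Tychonoff_space_def)

lemma Tychonoff_space_subtopology: "Tychonoff_space X \<Longrightarrow> Tychonoff_space (subtopology X S)"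
  by (simp add: Tychonoff_space_def completely_regular_space_subtopology Hausdorff_space_subtopology)

lemma Tychonoff_space_product_topology:
  "(\<And>i. i \<in> I \<Longrightarrow> Tychonoff_space (X i)) \<Longrightarrow> Tychonoff_space (product_topology X I)"
  by (simp add: Tychonoff_space_def completely_regular_space_product_topology Hausdorff_space_product_topology)

lemma metrizable_imp_Tychonoff_space: "metrizable_space X \<Longrightarrow> Tychonoff_space X"
  by (simp add: Tychonoff_space_def metrizable_imp_completely_regular_space metrizable_imp_Hausdorff_space)

lemma Tychonoff_space_euclideanreal: "Tychonoff_space euclideanreal"
  by (intro metrizable_imp_Tychonoff_space metrizable_space_euclidean)

lemma topspace_Cp:
  "f \<in> topspace (Cp Y) \<longleftrightarrow> f \<in> extensional (topspace Y) \<and> continuous_map Y euclideanreal f"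
  by (auto simp: Cp_def PiE_def)

text \<open>Points of \<^term>\<open>Cp Y\<close> are extensional, so a continuous function determines a point of the function
  space only after restriction to \<^term>\<open>topspace Y\<close>.\<close>

lemma restrict_in_Cp:
  assumes "continuous_map Y euclideanreal f"
  shows "restrict f (topspace Y) \<in> topspace (Cp Y)"
  using continuous_map_eq[OF assms, of "restrict f (topspace Y)"] by (simp add: topspace_Cp)

lemma Cp_eval: "y \<in> topspace Y \<Longrightarrow> continuous_map (Cp Y) euclideanreal (\<lambda>f. f y)"
  unfolding Cp_def by (intro continuous_map_from_subtopology continuous_map_product_projection)

lemma continuous_map_Cp:
  "continuous_map T (Cp Y) h \<longleftrightarrow>
     (\<forall>t\<in>topspace T. h t \<in> topspace (Cp Y)) \<and>
     (\<forall>y\<in>topspace Y. continuous_map T euclideanreal (\<lambda>t. h t y))"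
  by (auto simp: Cp_def continuous_map_in_subtopology continuous_map_componentwise PiE_def)

lemma limitin_Cp:
  "limitin (Cp Y) h g F \<longleftrightarrow> g \<in> topspace (Cp Y) \<and> eventually (\<lambda>t. h t \<in> topspace (Cp Y)) F \<and>
     (\<forall>y\<in>topspace Y. ((\<lambda>t. h t y) \<longlongrightarrow> g y) F)" (is "?L \<longleftrightarrow> ?R")
proof
  assume ?L then show ?R
    by (auto simp: Cp_def limitin_subtopology limitin_componentwise eventually_conj_iff PiE_def)
next
  assume ?R then show ?L
    by (auto simp: Cp_def limitin_subtopology limitin_componentwise eventually_conj_iff PiE_def)
qed

lemma Tychonoff_space_Cp: "Tychonoff_space (Cp Y)"
  unfolding Cp_def
  by (intro Tychonoff_space_subtopology Tychonoff_space_product_topology Tychonoff_space_euclideanreal)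

lemma Hausdorff_space_Cp: "Hausdorff_space (Cp Y)"
  by (rule Tychonoff_imp_Hausdorff_space[OF Tychonoff_space_Cp])

text \<open>The topology of a completely regular space is induced by its continuous functions.\<close>

lemma limitin_completely_regular:
  assumes X: "completely_regular_space X" and l: "l \<in> topspace X"
    and ev: "eventually (\<lambda>t. g t \<in> topspace X) F"
    and lim: "\<And>f. f \<in> topspace (Cp X) \<Longrightarrow> ((\<lambda>t. f (g t)) \<longlongrightarrow> f l) F"
  shows "limitin X g l F"
  unfolding limitin_def
proof (intro conjI allI impI; (elim conjE)?)
  fix U assume U: "openin X U" "l \<in> U"
  obtain f where f: "continuous_map X euclideanreal f" "f l = 0" "f ` (topspace X - U) \<subseteq> {1::real}"
    using X U unfolding completely_regular_space_alt' by meson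
  define h where "h = restrict f (topspace X)"
  have "((\<lambda>t. h (g t)) \<longlongrightarrow> h l) F"
    unfolding h_def by (intro lim restrict_in_Cp f)
  then have "eventually (\<lambda>t. h (g t) < 1) F"
    by (rule order_tendstoD(2)) (use f l in \<open>simp add: h_def\<close>)
  with ev show "eventually (\<lambda>t. g t \<in> U) F"
    by eventually_elim (use f(3) in \<open>force simp: h_def\<close>)
qed (rule l)

lemma continuous_map_into_completely_regular:
  assumes X: "completely_regular_space X" and g: "\<And>t. t \<in> topspace T \<Longrightarrow> g t \<in> topspace X"
    and f: "\<And>f. f \<in> topspace (Cp X) \<Longrightarrow> continuous_map T euclideanreal (\<lambda>t. f (g t))"
  shows "continuous_map T X g"
  unfolding continuous_map_atin
proof
  fix t assume t: "t \<in> topspace T"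
  show "limitin X g (g t) (atin T t)"
  proof (rule limitin_completely_regular[OF X])
    have "eventually (\<lambda>t. t \<in> topspace T) (atin T t)"
      by (auto simp: eventually_atin)
    then show "eventually (\<lambda>t. g t \<in> topspace X) (atin T t)"
      by eventually_elim (rule g)
    show "((\<lambda>t. f (g t)) \<longlongrightarrow> f (g t)) (atin T t)" if "f \<in> topspace (Cp X)" for f
      using f[OF that] t by (simp add: continuous_map_atin)
  qed (use g t in auto)
qed

lemma Cp_separates_points:
  assumes X: "Tychonoff_space X" and xy: "x \<in> topspace X" "y \<in> topspace X"
    and eq: "\<And>f. f \<in> topspace (Cp X) \<Longrightarrow> f x = f y"
  shows "x = y"
proof -
  have "limitin X (\<lambda>u::unit. y) x (principal {()})"
  proof (rule limitin_completely_regular)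
    show "((\<lambda>u::unit. f y) \<longlongrightarrow> f x) (principal {()})" if "f \<in> topspace (Cp X)" for f
      using eq[OF that] by simp
  qed (use X xy in \<open>auto simp: Tychonoff_space_def\<close>)
  moreover have "limitin X (\<lambda>u::unit. y) y (principal {()})"
    using xy by simp
  moreover have "principal {()} \<noteq> bot" "Hausdorff_space X"
    using X by (auto simp: Tychonoff_space_def principal_eq_bot_iff)
  ultimately show ?thesis
    by (rule limitin_Hausdorff_unique)
qed

lemma exists_filter_closure:
  assumes "p \<in> Y closure_of (e ` A)"
  obtains F where "F \<noteq> bot" "eventually (\<lambda>x. x \<in> A) F" "limitin Y e p F"
proof
  define F where "F = inf (principal A) (filtercomap e (nhdsin Y p))"
  have p: "p \<in> topspace Y"
    using assms by (simp add: in_closure_of)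
  show "F \<noteq> bot"
  proof
    assume "F = bot"
    then have "eventually (\<lambda>x. x \<notin> A) (filtercomap e (nhdsin Y p))"
      by (simp add: F_def trivial_limit_def eventually_inf_principal inf_commute[of "principal A"])
    then obtain S where "openin Y S" "p \<in> S" "\<And>x. e x \<in> S \<Longrightarrow> x \<notin> A"
      using p by (auto simp: eventually_filtercomap eventually_nhdsin)
    then show False
      using assms by (auto simp: in_closure_of)
  qed
  show "eventually (\<lambda>x. x \<in> A) F"
    by (simp add: F_def eventually_inf_principal inf_commute[of "principal A"])
  show "limitin Y e p F"
    unfolding limitin_def
  proof (intro conjI allI impI)
    fix U assume "openin Y U \<and> p \<in> U"
    then have "eventually (\<lambda>y. y \<in> U) (nhdsin Y p)"
      by (auto simp: eventually_nhdsin)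
    then have "eventually (\<lambda>x. e x \<in> U) (filtercomap e (nhdsin Y p))"
      by (rule eventually_filtercomapI)
    then show "eventually (\<lambda>x. e x \<in> U) F"
      by (simp add: F_def eventually_inf_principal inf_commute[of "principal A"] eventually_mono)
  qed (rule p)
qed

lemma limitin_filtermap_iff: "limitin X f l (filtermap p F) \<longleftrightarrow> limitin X (f \<circ> p) l F"
  by (simp add: limitin_def eventually_filtermap)

section \<open>Kappa-Cauchy filters and kappa-complete spaces\<close>

text \<open>The \<open>\<kappa>\<close>-Cauchy filters.  The value \<^term>\<open>Lim F f\<close> is meaningful, being the unique limit, whenever \<^term>\<open>f\<close> is
  continuous; the third condition says that every such \<^term>\<open>f\<close> converges along \<^term>\<open>F\<close>, and the fourth
  considers \<^term>\<open>Lim F\<close> as a function on the space \<^term>\<open>Cp X\<close> only.\<close>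

definition kappa_Cauchy :: "'a topology \<Rightarrow> 'a filter \<Rightarrow> bool" where
  "kappa_Cauchy X F \<longleftrightarrow>
     F \<noteq> bot \<and> eventually (\<lambda>x. x \<in> topspace X) F \<and>
     (\<forall>f :: 'a \<Rightarrow> real. continuous_map X euclideanreal f \<longrightarrow> (f \<longlongrightarrow> Lim F f) F) \<and>
     (\<forall>K. compactin (Cp X) K \<longrightarrow> continuous_map (subtopology (Cp X) K) euclideanreal (Lim F))"

text \<open>The notion of completeness that characterises \<open>\<kappa>\<close>-spaces among Tychonoff spaces.  It quantifies over
  filters on the type of points of \<^term>\<open>X\<close> and thus involves no other type.\<close>

definition kappa_complete :: "'a topology \<Rightarrow> bool" where
  "kappa_complete X \<longleftrightarrow> (\<forall>F. kappa_Cauchy X F \<longrightarrow> (\<exists>l. limitin X (\<lambda>x. x) l F))"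

lemma kappa_Cauchy_filtermap:
  fixes p :: "'a \<Rightarrow> 'b"
  assumes F: "kappa_Cauchy X F" and p: "continuous_map X Y p"
  shows "kappa_Cauchy Y (filtermap p F)"
proof -
  have nb: "F \<noteq> bot" and ev: "eventually (\<lambda>x. x \<in> topspace X) F"
    and lim: "\<And>f. continuous_map X euclideanreal f \<Longrightarrow> (f \<longlongrightarrow> Lim F f) F"
    and cont: "\<And>K. compactin (Cp X) K \<Longrightarrow> continuous_map (subtopology (Cp X) K) euclideanreal (Lim F)"
    using F by (auto simp: kappa_Cauchy_def)
  \<comment> \<open>composition with \<open>p\<close>, a continuous map from \<open>Cp Y\<close> to \<open>Cp X\<close>\<close>
  define P where "P g = restrict (g \<circ> p) (topspace X)" for g :: "'b \<Rightarrow> real"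
  have nb': "filtermap p F \<noteq> bot"
    using nb by (simp add: filtermap_bot_iff)
  have gp: "continuous_map X euclideanreal (g \<circ> p)" if "continuous_map Y euclideanreal g" for g
    using p that by (rule continuous_map_compose)
  have lim': "(g \<longlongrightarrow> Lim F (P g)) (filtermap p F)" if "continuous_map Y euclideanreal g" for g
  proof -
    have "Lim F (P g) = Lim F (g \<circ> p)"
      using ev by (intro Lim_cong) (auto simp: P_def elim: eventually_mono)
    then show ?thesis
      using lim[OF gp[OF that]] by (simp add: filterlim_def filtermap_filtermap o_def)
  qed
  then have eq: "Lim (filtermap p F) g = Lim F (P g)" if "continuous_map Y euclideanreal g" for g
    using that nb' by (simp add: tendsto_Lim)
  have Pc: "continuous_map (Cp Y) (Cp X) P"
    unfolding continuous_map_Cp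
  proof (intro conjI ballI)
    fix g assume "g \<in> topspace (Cp Y)"
    then show "P g \<in> topspace (Cp X)"
      unfolding P_def by (intro restrict_in_Cp gp) (simp add: topspace_Cp)
  next
    fix x assume x: "x \<in> topspace X"
    then have "p x \<in> topspace Y"
      using p by (auto simp: continuous_map_def)
    from Cp_eval[OF this] show "continuous_map (Cp Y) euclideanreal (\<lambda>g. P g x)"
      using x by (simp add: P_def)
  qed
  show ?thesis
    unfolding kappa_Cauchy_def
  proof (intro conjI allI impI)
    show "eventually (\<lambda>y. y \<in> topspace Y) (filtermap p F)"
      unfolding eventually_filtermap using ev
      by eventually_elim (use p in \<open>auto simp: continuous_map_def\<close>)
    fix K assume K: "compactin (Cp Y) K"
    then have "compactin (Cp X) (P ` K)"
      using Pc image_compactin by blast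
    moreover have "continuous_map (subtopology (Cp Y) K) (subtopology (Cp X) (P ` K)) P"
      using Pc by (auto simp: continuous_map_in_subtopology intro: continuous_map_from_subtopology)
    ultimately have "continuous_map (subtopology (Cp Y) K) euclideanreal (Lim F \<circ> P)"
      using cont continuous_map_compose by blast
    then show "continuous_map (subtopology (Cp Y) K) euclideanreal (Lim (filtermap p F))"
      by (rule continuous_map_eq) (simp add: topspace_Cp eq)
  qed (use lim' eq nb' in auto)
qed

text \<open>The form in which completeness is mostly used: a \<open>\<kappa>\<close>-Cauchy filter on any space converges after it is
  mapped continuously into a \<open>\<kappa>\<close>-complete space.\<close>

lemma kappa_completeD:
  assumes "kappa_complete Y" "kappa_Cauchy X F" "continuous_map X Y p"
  obtains l where "limitin Y p l F"
  using assms kappa_Cauchy_filtermap[of X F Y p] limitin_filtermap_iff[of Y "\<lambda>x. x" _ p F]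
  unfolding kappa_complete_def by (auto simp: o_def)

text \<open>The limit of a continuous function along the filter is its value at each cluster point, and complete
  regularity then turns the cluster point into a limit.\<close>

lemma kappa_Cauchy_cluster:
  assumes X: "completely_regular_space X" and F: "kappa_Cauchy X F" and x: "x \<in> topspace X"
    and cl: "\<And>U. openin X U \<Longrightarrow> x \<in> U \<Longrightarrow> frequently (\<lambda>y. y \<in> U) F"
  shows "limitin X (\<lambda>x. x) x F"
  unfolding limitin_def
proof (intro conjI allI impI; (elim conjE)?)
  fix U assume U: "openin X U" "x \<in> U"
  obtain f where f: "continuous_map X euclideanreal f" "f x = 0" "f ` (topspace X - U) \<subseteq> {1::real}"
    using X U unfolding completely_regular_space_alt' by meson
  have lim: "(f \<longlongrightarrow> Lim F f) F"
    using F f by (simp add: kappa_Cauchy_def)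
  have "Lim F f < 1"
  proof (rule ccontr)
    assume "\<not> Lim F f < 1"
    then have ev: "eventually (\<lambda>y. f y > 1/2) F"
      by (intro order_tendstoD(1)[OF lim]) simp
    have "openin X {y \<in> topspace X. f y \<in> {..<1/2}}"
      by (rule openin_continuous_map_preimage[OF f(1)]) simp
    from cl[OF this] have "frequently (\<lambda>y. f y < 1/2) F"
      using f x by (auto elim: frequently_elim1)
    from frequently_eventually_conj[OF this ev] show False
      by (auto dest: frequently_ex)
  qed
  then have "eventually (\<lambda>y. f y < 1) F"
    by (rule order_tendstoD(2)[OF lim])
  moreover have "eventually (\<lambda>y. y \<in> topspace X) F"
    using F by (simp add: kappa_Cauchy_def)
  ultimately show "eventually (\<lambda>y. y \<in> U) F"
    by eventually_elim (use f(3) in force)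
qed (rule x)

section \<open>Permanence properties of kappa-completeness\<close>

lemma kappa_complete_closed_subtopology:
  assumes "kappa_complete X" and C: "closedin X C"
  shows "kappa_complete (subtopology X C)"
  unfolding kappa_complete_def
proof (intro strip)
  fix F assume F: "kappa_Cauchy (subtopology X C) F"
  have "continuous_map (subtopology X C) X (\<lambda>x. x)"
    by (rule continuous_map_from_subtopology) (simp add: id_def[symmetric])
  then obtain l where l: "limitin X (\<lambda>x. x) l F"
    using kappa_completeD[OF assms(1) F] by blast
  have evC: "eventually (\<lambda>x. x \<in> C) F" and "F \<noteq> bot"
    using F by (auto simp: kappa_Cauchy_def eventually_conj_iff)
  then have "l \<in> C"
    using limitin_closedin[OF l C] by blast
  then show "\<exists>l. limitin (subtopology X C) (\<lambda>x. x) l F"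
    using l evC by (auto simp: limitin_subtopology)
qed

lemma kappa_complete_homeomorphic:
  assumes Y: "kappa_complete Y" and hom: "X homeomorphic_space Y"
  shows "kappa_complete X"
  unfolding kappa_complete_def
proof (intro strip)
  fix F assume F: "kappa_Cauchy X F"
  obtain h g where h: "continuous_map X Y h" and g: "continuous_map Y X g"
    and gh: "\<And>x. x \<in> topspace X \<Longrightarrow> g (h x) = x"
    using hom by (auto simp: homeomorphic_space_def homeomorphic_maps_def)
  obtain l where l: "limitin Y h l F"
    using kappa_completeD[OF Y F h] by blast
  have "limitin X (\<lambda>x. x) (g l) F"
  proof (rule limitin_transform_eventually)
    show "limitin X (g \<circ> h) (g l) F"
      using continuous_map_limit[OF g l] .
    have "eventually (\<lambda>x. x \<in> topspace X) F"
      using F by (simp add: kappa_Cauchy_def)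
    then show "eventually (\<lambda>x. (g \<circ> h) x = x) F"
      by eventually_elim (simp add: gh)
  qed
  then show "\<exists>l. limitin X (\<lambda>x. x) l F" by blast
qed

lemma kappa_complete_product_topology:
  assumes "\<And>i. i \<in> I \<Longrightarrow> kappa_complete (X i)"
  shows "kappa_complete (product_topology X I)"
  unfolding kappa_complete_def
proof (intro strip)
  fix F assume F: "kappa_Cauchy (product_topology X I) F"
  have "\<exists>l. limitin (X i) (\<lambda>x. x i) l F" if "i \<in> I" for i
    using kappa_completeD[OF assms[OF that] F] continuous_map_product_projection[OF that] by blast
  then obtain l where l: "\<And>i. i \<in> I \<Longrightarrow> limitin (X i) (\<lambda>x. x i) (l i) F"
    by metis
  have "limitin (product_topology X I) (\<lambda>x. x) (restrict l I) F"
    using F l by (simp add: limitin_componentwise kappa_Cauchy_def)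
  then show "\<exists>l. limitin (product_topology X I) (\<lambda>x. x) l F" by blast
qed

text \<open>The filter converges in every member of the family, and by the Hausdorff property to the same point of \<^term>\<open>X\<close>.\<close>

lemma kappa_complete_Inter:
  assumes X: "Hausdorff_space X" and ne: "\<M> \<noteq> {}"
    and M: "\<And>S. S \<in> \<M> \<Longrightarrow> kappa_complete (subtopology X S)"
  shows "kappa_complete (subtopology X (\<Inter>\<M>))"
  unfolding kappa_complete_def
proof (intro strip)
  fix F assume F: "kappa_Cauchy (subtopology X (\<Inter>\<M>)) F"
  then have nb: "F \<noteq> bot" and ev: "eventually (\<lambda>x. x \<in> \<Inter>\<M>) F"
    by (auto simp: kappa_Cauchy_def elim: eventually_mono)
  have lim: "\<exists>l\<in>S. limitin X (\<lambda>x. x) l F" if S: "S \<in> \<M>" for S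
  proof -
    have "continuous_map (subtopology X (\<Inter>\<M>)) (subtopology X S) (\<lambda>x. x)"
      using S by (auto simp: continuous_map_in_subtopology continuous_map_from_subtopology id_def[symmetric])
    then obtain l where "limitin (subtopology X S) (\<lambda>x. x) l F"
      using kappa_completeD[OF M[OF S] F] by blast
    then show ?thesis by (auto simp: limitin_subtopology)
  qed
  with ne obtain l where l: "limitin X (\<lambda>x. x) l F" by blast
  have "l \<in> S" if S: "S \<in> \<M>" for S
    using lim[OF S] limitin_Hausdorff_unique[OF _ l nb X] by blast
  then show "\<exists>l. limitin (subtopology X (\<Inter>\<M>)) (\<lambda>x. x) l F"
    using l ev by (auto simp: limitin_subtopology)
qed

lemma kappa_complete_euclideanreal: "kappa_complete euclideanreal"
  unfolding kappa_complete_def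
proof (intro strip)
  fix F assume "kappa_Cauchy euclideanreal F"
  then have "((\<lambda>x. x) \<longlongrightarrow> Lim F (\<lambda>x. x)) F"
    by (simp add: kappa_Cauchy_def)
  then show "\<exists>l. limitin euclideanreal (\<lambda>x. x) l F"
    by auto
qed

text \<open>Perfect preimages.  The image of the filter converges to some \<open>y\<close>; were there no cluster point in the compact
  fibre over \<open>y\<close>, the filter would avoid a neighbourhood of the fibre, and hence, the map being closed, the
  preimage of a neighbourhood of \<open>y\<close>.\<close>

lemma kappa_complete_perfect:
  assumes X: "completely_regular_space X" and Y: "kappa_complete Y"
    and f: "continuous_map X Y f" "closed_map X Y f"
    and fib: "\<And>y. y \<in> topspace Y \<Longrightarrow> compactin X {x \<in> topspace X. f x = y}"
  shows "kappa_complete X"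
  unfolding kappa_complete_def
proof (intro strip, rule ccontr)
  fix F assume F: "kappa_Cauchy X F" and non: "\<nexists>l. limitin X (\<lambda>x. x) l F"
  obtain y where y: "limitin Y f y F"
    using kappa_completeD[OF Y F f(1)] by blast
  then have yY: "y \<in> topspace Y"
    by (rule limitin_topspace)
  define \<U> where "\<U> = {U. openin X U \<and> eventually (\<lambda>x. x \<notin> U) F}"
  have "{x \<in> topspace X. f x = y} \<subseteq> \<Union>\<U>"
  proof clarify
    fix x assume "x \<in> topspace X" "y = f x"
    then obtain U where "openin X U" "x \<in> U" "\<not> frequently (\<lambda>y. y \<in> U) F"
      using kappa_Cauchy_cluster[OF X F] non by blast
    then show "x \<in> \<Union>\<U>"
      by (auto simp: \<U>_def frequently_def)
  qed
  then obtain \<V> where \<V>: "finite \<V>" "\<V> \<subseteq> \<U>" "{x \<in> topspace X. f x = y} \<subseteq> \<Union>\<V>"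
    using compactinD[OF fib[OF yY], of \<U>] by (auto simp: \<U>_def)
  have "openin X (\<Union>\<V>)"
    using \<V> by (auto simp: \<U>_def)
  then obtain W where W: "openin Y W" "y \<in> W" "{x \<in> topspace X. f x \<in> W} \<subseteq> \<Union>\<V>"
    using f(2) \<V>(3) yY unfolding closed_map_fibre_neighbourhood by meson
  have "eventually (\<lambda>x. \<forall>U\<in>\<V>. x \<notin> U) F"
    using \<V> by (intro eventually_ball_finite) (auto simp: \<U>_def)
  moreover have "eventually (\<lambda>x. f x \<in> W) F"
    using y W by (auto simp: limitin_def)
  moreover have "eventually (\<lambda>x. x \<in> topspace X) F"
    using F by (simp add: kappa_Cauchy_def)
  ultimately have "eventually (\<lambda>x. False) F"
    by eventually_elim (use W in auto)
  then show False
    using F by (simp add: kappa_Cauchy_def)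
qed

text \<open>A compact space is mapped perfectly into the real line by a constant function.\<close>

lemma kappa_complete_compact:
  assumes T: "Tychonoff_space X" and X: "compact_space X"
  shows "kappa_complete X"
proof (rule kappa_complete_perfect[OF _ kappa_complete_euclideanreal])
  show "closed_map X euclideanreal (\<lambda>_. 0)"
    using X by (intro continuous_imp_closed_map_gen) (auto simp: Hausdorff_imp_kc_space)
  show "compactin X {x \<in> topspace X. 0 = y}" for y :: real
    using X by (cases "y = 0") (auto simp: compact_space_def)
qed (use T in \<open>auto simp: Tychonoff_space_def\<close>)

section \<open>Kappa-spaces are the kappa-complete Tychonoff spaces\<close>

text \<open>The pointwise limit of a \<open>\<kappa>\<close>-Cauchy filter of continuous functions is continuous.  The premise is the
  \<open>k\<^sub>\<real>\<close>-property of \<^term>\<open>Y\<close>, without any separation axiom, so that the lemma serves locally compact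
  spaces as well.\<close>

lemma kappa_complete_Cp:
  fixes Y :: "'b topology"
  assumes kR: "\<And>f :: 'b \<Rightarrow> real. (\<And>K. compactin Y K \<Longrightarrow> continuous_map (subtopology Y K) euclideanreal f)
                 \<Longrightarrow> continuous_map Y euclideanreal f"
  shows "kappa_complete (Cp Y)"
  unfolding kappa_complete_def
proof (intro strip)
  fix F assume F: "kappa_Cauchy (Cp Y) F"
  \<comment> \<open>evaluation at \<open>y\<close>, as a point of \<open>Cp (Cp Y)\<close>\<close>
  define e where "e y = restrict (\<lambda>f. f y) (topspace (Cp Y))" for y :: 'b
  have ev: "eventually (\<lambda>f. f \<in> topspace (Cp Y)) F"
    using F by (simp add: kappa_Cauchy_def)
  have eC: "e y \<in> topspace (Cp (Cp Y))" if "y \<in> topspace Y" for y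
    unfolding e_def by (intro restrict_in_Cp Cp_eval that)
  have e: "continuous_map Y (Cp (Cp Y)) e"
    unfolding continuous_map_Cp[of Y "Cp Y"]
    using eC by (auto simp: e_def topspace_Cp)
  define g where "g = restrict (\<lambda>y. Lim F (e y)) (topspace Y)"
  have "continuous_map Y euclideanreal g"
  proof (rule kR)
    fix K assume K: "compactin Y K"
    then have "compactin (Cp (Cp Y)) (e ` K)"
      using e image_compactin by blast
    then have "continuous_map (subtopology (Cp (Cp Y)) (e ` K)) euclideanreal (Lim F)"
      using F by (simp add: kappa_Cauchy_def)
    moreover have "continuous_map (subtopology Y K) (subtopology (Cp (Cp Y)) (e ` K)) e"
      using e by (auto simp: continuous_map_in_subtopology intro: continuous_map_from_subtopology)
    ultimately have "continuous_map (subtopology Y K) euclideanreal (Lim F \<circ> e)"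
      using continuous_map_compose by blast
    then show "continuous_map (subtopology Y K) euclideanreal g"
      by (rule continuous_map_eq) (simp add: g_def)
  qed
  then have gC: "g \<in> topspace (Cp Y)"
    by (simp add: topspace_Cp g_def)
  have "((\<lambda>f. f y) \<longlongrightarrow> g y) F" if y: "y \<in> topspace Y" for y
  proof -
    have "(e y \<longlongrightarrow> Lim F (e y)) F"
      using eC[OF y] F by (simp add: kappa_Cauchy_def topspace_Cp[of _ "Cp Y"])
    moreover have "eventually (\<lambda>f. e y f = f y) F"
      using ev by eventually_elim (simp add: e_def)
    ultimately show ?thesis
      using y by (simp add: g_def tendsto_cong)
  qed
  with ev gC have "limitin (Cp Y) (\<lambda>f. f) g F"
    by (simp add: limitin_Cp)
  then show "\<exists>l. limitin (Cp Y) (\<lambda>x. x) l F" by blast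
qed

lemma locally_compact_imp_kR:
  fixes f :: "'a \<Rightarrow> real"
  assumes lc: "locally_compact_space Y"
    and f: "\<And>K. compactin Y K \<Longrightarrow> continuous_map (subtopology Y K) euclideanreal f"
  shows "continuous_map Y euclideanreal f"
proof (rule pasting_lemma[of "{U. openin Y U \<and> (\<exists>K. compactin Y K \<and> U \<subseteq> K)}" Y "\<lambda>U. U" _ "\<lambda>_. f"])
  show "\<exists>j. j \<in> {U. openin Y U \<and> (\<exists>K. compactin Y K \<and> U \<subseteq> K)} \<and> x \<in> j \<and> f x = f x"
    if "x \<in> topspace Y" for x
    using lc that unfolding locally_compact_space_def by blast
qed (use f in \<open>auto intro: continuous_map_from_subtopology_mono\<close>)

lemma kappa_space_imp_complete:
  assumes "kappa_space X" shows "kappa_complete X"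
proof -
  obtain Y :: "(('a \<Rightarrow> real) set \<times> ('a \<Rightarrow> real)) topology" and C
    where "locally_compact_space Y" "closedin (Cp Y) C" "X homeomorphic_space subtopology (Cp Y) C"
    using assms by (auto simp: kappa_space_def)
  then show ?thesis
    by (meson kappa_complete_Cp kappa_complete_closed_subtopology kappa_complete_homeomorphic
        locally_compact_imp_kR)
qed

lemma continuous_map_sum_topology:
  "continuous_map (sum_topology X I) Y f \<longleftrightarrow> (\<forall>i\<in>I. continuous_map (X i) Y (\<lambda>x. f (i, x)))"
    (is "?L \<longleftrightarrow> ?R")
proof
  assume L: ?L
  show ?R
  proof
    fix i assume "i \<in> I"
    from continuous_map_compose[OF continuous_map_component_injection[OF this, of X] L]
    show "continuous_map (X i) Y (\<lambda>x. f (i, x))"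
      by (simp add: o_def)
  qed
next
  assume R: ?R
  show ?L
    unfolding continuous_map_def
  proof (intro conjI strip)
    show "f \<in> topspace (sum_topology X I) \<rightarrow> topspace Y"
      using R by (fastforce simp: continuous_map_def)
    fix U assume U: "openin Y U"
    show "openin (sum_topology X I) {x \<in> topspace (sum_topology X I). f x \<in> U}"
      unfolding openin_sum_topology
    proof (intro conjI ballI)
      fix i assume i: "i \<in> I"
      have "{x. (i, x) \<in> {x \<in> topspace (sum_topology X I). f x \<in> U}} = {x \<in> topspace (X i). f (i, x) \<in> U}"
        using i by auto
      then show "openin (X i) {x. (i, x) \<in> {x \<in> topspace (sum_topology X I). f x \<in> U}}"
        using R i U openin_continuous_map_preimage by fastforce
    qed auto
  qed
qed

lemma Hausdorff_space_sum_topology: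
  assumes "\<And>i. i \<in> I \<Longrightarrow> Hausdorff_space (X i)"
  shows "Hausdorff_space (sum_topology X I)"
  unfolding Hausdorff_space_def
proof (intro strip, elim conjE)
  fix p q assume p: "p \<in> topspace (sum_topology X I)" and q: "q \<in> topspace (sum_topology X I)" and "p \<noteq> q"
  obtain i x j y where pq: "p = (i, x)" "q = (j, y)" by fastforce
  have op: "openin (sum_topology X I) (Pair k ` W)" if "k \<in> I" "openin (X k) W" for k W
    using open_map_component_injection[OF that(1), of X] that unfolding open_map_def by blast
  have ij: "i \<in> I" "j \<in> I" "x \<in> topspace (X i)" "y \<in> topspace (X j)"
    using p q pq by auto
  show "\<exists>U V. openin (sum_topology X I) U \<and> openin (sum_topology X I) V \<and> p \<in> U \<and> q \<in> V \<and> disjnt U V"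
  proof (cases "i = j")
    case False
    show ?thesis
      by (rule exI[of _ "Pair i ` topspace (X i)"], rule exI[of _ "Pair j ` topspace (X j)"])
        (use ij op False in \<open>auto simp: pq disjnt_def\<close>)
  next
    case True
    then have "y \<in> topspace (X i)" "x \<noteq> y"
      using ij pq \<open>p \<noteq> q\<close> by auto
    then obtain U V where "openin (X i) U" "openin (X i) V" "x \<in> U" "y \<in> V" "disjnt U V"
      using assms[OF ij(1)] ij unfolding Hausdorff_space_def by meson
    then show ?thesis
      by (intro exI[of _ "Pair i ` U"] exI[of _ "Pair i ` V"])
        (use op ij True in \<open>auto simp: pq disjnt_def\<close>)
  qed
qed

text \<open>The converse: a closed embedding of \<^term>\<open>X\<close> in the function space of the disjoint sum \<open>Z\<close> of the compact
  subsets of \<^term>\<open>Cp X\<close>.  The points of \<open>Z\<close> are the pairs \<open>(K, f)\<close> with \<open>f \<in> K\<close>.\<close>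

lemma kappa_complete_imp_space:
  fixes X :: "'a topology"
  assumes T: "Tychonoff_space X" and X: "kappa_complete X"
  shows "kappa_space X"
proof -
  define \<K> where "\<K> = {K. compactin (Cp X) K}"
  define Z where "Z = sum_topology (\<lambda>K. subtopology (Cp X) K) \<K>"
  have topZ: "(K, f) \<in> topspace Z \<longleftrightarrow> compactin (Cp X) K \<and> f \<in> K" for K f
    using compactin_subset_topspace by (fastforce simp: Z_def \<K>_def)
  have ZCp: "f \<in> topspace (Cp X)" if "(K, f) \<in> topspace Z" for K f
    using that compactin_subset_topspace by (fastforce simp: topZ)
  have sing: "({f}, f) \<in> topspace Z" if "f \<in> topspace (Cp X)" for f
    using that by (simp add: topZ)
  have lcZ: "locally_compact_space Z"
    unfolding Z_def locally_compact_space_sum_topology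
    by (auto intro!: compact_imp_locally_compact_space compact_space_subtopology simp: \<K>_def)
  have HZ: "Hausdorff_space Z"
    unfolding Z_def
    by (intro Hausdorff_space_sum_topology Hausdorff_space_subtopology Hausdorff_space_Cp)
  define e where "e x = restrict (\<lambda>p. snd p x) (topspace Z)" for x :: 'a
  have eC: "e x \<in> topspace (Cp Z)" if x: "x \<in> topspace X" for x
  proof -
    have "continuous_map Z euclideanreal (\<lambda>p. snd p x)"
      unfolding Z_def continuous_map_sum_topology
      using Cp_eval[OF x] by (auto intro: continuous_map_from_subtopology)
    then show ?thesis
      unfolding e_def by (rule restrict_in_Cp)
  qed
  have e: "continuous_map X (Cp Z) e"
    unfolding continuous_map_Cp
  proof (intro conjI ballI)
    fix p assume p: "p \<in> topspace Z"
    then have "snd p \<in> topspace (Cp X)"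
      using ZCp[of "fst p" "snd p"] by simp
    then show "continuous_map X euclideanreal (\<lambda>x. e x p)"
      using p by (simp add: topspace_Cp e_def)
  qed (use eC in blast)
  \<comment> \<open>the image of \<open>X\<close> is closed: a point \<open>\<phi>\<close> of its closure is the limit of a \<open>\<kappa>\<close>-Cauchy filter\<close>
  define C where "C = e ` topspace X"
  have "(Cp Z) closure_of C \<subseteq> C"
  proof
    fix \<phi> assume "\<phi> \<in> (Cp Z) closure_of C"
    then obtain F where F: "F \<noteq> bot" "eventually (\<lambda>x. x \<in> topspace X) F" "limitin (Cp Z) e \<phi> F"
      unfolding C_def by (rule exists_filter_closure)
    have \<phi>: "\<phi> \<in> topspace (Cp Z)"
      using F(3) by (rule limitin_topspace)
    have lim: "((\<lambda>x. f x) \<longlongrightarrow> \<phi> (K, f)) F" if "(K, f) \<in> topspace Z" for K f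
    proof -
      have "((\<lambda>x. e x (K, f)) \<longlongrightarrow> \<phi> (K, f)) F"
        using F(3) that by (simp add: limitin_Cp)
      then show ?thesis
        using that by (simp add: e_def)
    qed
    have Lim: "Lim F f = \<phi> (K, f)" if "(K, f) \<in> topspace Z" for K f
      using lim[OF that] F(1) by (simp add: tendsto_Lim)
    have "kappa_Cauchy X F"
      unfolding kappa_Cauchy_def
    proof (intro conjI allI impI)
      fix f :: "'a \<Rightarrow> real" assume f: "continuous_map X euclideanreal f"
      define g where "g = restrict f (topspace X)"
      \<comment> \<open>singletons are compact, so every continuous function occurs as a coordinate\<close>
      have "({g}, g) \<in> topspace Z"
        unfolding g_def by (intro sing restrict_in_Cp f)
      from lim[OF this] have "(g \<longlongrightarrow> \<phi> ({g}, g)) F" .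
      moreover have "eventually (\<lambda>x. g x = f x) F"
        using F(2) by eventually_elim (simp add: g_def)
      ultimately have "(f \<longlongrightarrow> \<phi> ({g}, g)) F"
        by (simp add: tendsto_cong)
      then show "(f \<longlongrightarrow> Lim F f) F"
        using F(1) by (simp add: tendsto_Lim)
    next
      fix K assume K: "compactin (Cp X) K"
      \<comment> \<open>on \<open>K\<close>, the limit functional is the restriction of \<open>\<phi>\<close> to the summand \<open>K\<close> of \<open>Z\<close>\<close>
      have "continuous_map (subtopology (Cp X) K) euclideanreal (\<lambda>f. \<phi> (K, f))"
        using \<phi> K by (simp add: topspace_Cp Z_def continuous_map_sum_topology \<K>_def)
      then show "continuous_map (subtopology (Cp X) K) euclideanreal (Lim F)"
        by (rule continuous_map_eq) (use K Lim[of K] in \<open>simp add: topZ\<close>)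
    qed (use F in auto)
    then obtain l where l: "limitin X (\<lambda>x. x) l F"
      using X by (auto simp: kappa_complete_def)
    have "limitin (Cp Z) e (e l) F"
      using continuous_map_limit[OF e l] by (simp add: o_def)
    then have "e l = \<phi>"
      using F limitin_Hausdorff_unique[OF _ _ _ Hausdorff_space_Cp] by blast
    then show "\<phi> \<in> C"
      using limitin_topspace[OF l] by (auto simp: C_def)
  qed
  moreover have "C \<subseteq> topspace (Cp Z)"
    using eC by (auto simp: C_def)
  ultimately have C: "closedin (Cp Z) C"
    by (metis closure_of_subset_eq)
  have injl: "inj_on e (topspace X)"
  proof (rule inj_onI)
    fix x y assume xy: "x \<in> topspace X" "y \<in> topspace X" "e x = e y"
    show "x = y"
    proof (rule Cp_separates_points[OF T xy(1,2)])
      fix f assume f: "f \<in> topspace (Cp X)"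
      show "f x = f y"
        using fun_cong[OF xy(3), of "({f}, f)"] sing[OF f] by (simp add: e_def)
    qed
  qed
  define g where "g = the_inv_into (topspace X) e"
  have gC: "g \<phi> \<in> topspace X" and eg: "e (g \<phi>) = \<phi>" if "\<phi> \<in> C" for \<phi>
    using that injl by (auto simp: g_def C_def the_inv_into_f_f)
  have g: "continuous_map (subtopology (Cp Z) C) X g"
  proof (rule continuous_map_into_completely_regular)
    fix f assume f: "f \<in> topspace (Cp X)"
    have "continuous_map (subtopology (Cp Z) C) euclideanreal (\<lambda>\<psi>. \<psi> ({f}, f))"
      by (rule continuous_map_from_subtopology[OF Cp_eval[OF sing[OF f]]])
    then show "continuous_map (subtopology (Cp Z) C) euclideanreal (\<lambda>\<psi>. f (g \<psi>))"
    proof (rule continuous_map_eq)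
      fix \<psi> assume "\<psi> \<in> topspace (subtopology (Cp Z) C)"
      then show "\<psi> ({f}, f) = f (g \<psi>)"
        using fun_cong[OF eg, of \<psi> "({f}, f)"] sing[OF f] by (simp add: e_def)
    qed
  qed (use T gC in \<open>auto simp: Tychonoff_space_def\<close>)
  have "homeomorphic_maps X (subtopology (Cp Z) C) e g"
    unfolding homeomorphic_maps_def
    using e g eg injl by (auto simp: continuous_map_in_subtopology C_def g_def the_inv_into_f_f)
  then have "X homeomorphic_space subtopology (Cp Z) C"
    unfolding homeomorphic_space_def by blast
  with C lcZ HZ T show ?thesis
    unfolding kappa_space_def by (intro exI conjI)
qed

lemma kappa_space_iff: "kappa_space X \<longleftrightarrow> Tychonoff_space X \<and> kappa_complete X"
  using kappa_complete_imp_space kappa_space_imp_complete kappa_space_def by blast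

lemma realcompact_imp_kappa_space:
  assumes "realcompact_space X"
  shows "kappa_space X"
proof -
  obtain I :: "('a \<Rightarrow> real) set" and C where C: "closedin (powertop_real I) C"
    and hom: "X homeomorphic_space subtopology (powertop_real I) C"
    using assms by (auto simp: realcompact_space_def)
  have "kappa_complete X"
    using hom C kappa_complete_euclideanreal
    by (intro kappa_complete_homeomorphic[OF _ hom] kappa_complete_closed_subtopology kappa_complete_product_topology)
  moreover have "Tychonoff_space (subtopology (powertop_real I) C)"
    by (intro Tychonoff_space_subtopology Tychonoff_space_product_topology Tychonoff_space_euclideanreal)
  then have "Tychonoff_space X"
    using hom homeomorphic_completely_regular_space homeomorphic_Hausdorff_space
    unfolding Tychonoff_space_def by metis
  ultimately show ?thesis
    by (simp add: kappa_space_iff)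
qed

section \<open>Spaces whose function space is a \<open>k\<^sub>\<real>\<close>-space\<close>

text \<open>A net of functions, indexed by the finite subsets of the space, whose members agree with \<^term>\<open>f\<close> on their
  index sets converges to \<^term>\<open>f\<close> in \<^term>\<open>Cp X\<close>.\<close>

lemma limitin_finite_subsets_Cp:
  assumes "\<And>A. finite A \<Longrightarrow> A \<subseteq> topspace X \<Longrightarrow> g A \<in> topspace (Cp X)"
    and "f \<in> topspace (Cp X)"
    and "\<And>A x. finite A \<Longrightarrow> A \<subseteq> topspace X \<Longrightarrow> x \<in> A \<Longrightarrow> g A x = f x"
  shows "limitin (Cp X) g f (finite_subsets_at_top (topspace X))"
  unfolding limitin_Cp
proof (intro conjI ballI)
  fix x assume "x \<in> topspace X"
  then have "eventually (\<lambda>A. g A x = f x) (finite_subsets_at_top (topspace X))"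
    unfolding eventually_finite_subsets_at_top
    by (intro exI[of _ "{x}"]) (auto simp: assms(3))
  then show "((\<lambda>A. g A x) \<longlongrightarrow> f x) (finite_subsets_at_top (topspace X))"
    by (rule tendsto_eventually)
qed (use assms in auto)

lemma kappa_complete_if_kR_Cp:
  assumes T: "Tychonoff_space X" and kR: "kR_space (Cp X)"
  shows "kappa_complete X"
  unfolding kappa_complete_def
proof (intro strip, rule ccontr)
  fix F assume F: "kappa_Cauchy X F" and non: "\<nexists>l. limitin X (\<lambda>x. x) l F"
  have cr: "completely_regular_space X"
    using T by (rule Tychonoff_imp_completely_regular_space)
  have nb: "F \<noteq> bot" and evX: "eventually (\<lambda>x. x \<in> topspace X) F"
    using F by (auto simp: kappa_Cauchy_def)
  have lam: "continuous_map (Cp X) euclideanreal (Lim F)"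
    using F kR by (simp add: kappa_Cauchy_def kR_space_def)
  \<comment> \<open>no point of the finite set \<open>A\<close> is a cluster point, so \<open>F\<close> avoids a neighbourhood of \<open>A\<close>\<close>
  have "\<exists>g\<in>topspace (Cp X). (\<forall>x\<in>A. g x = 0) \<and> eventually (\<lambda>x. g x = 1) F"
    if A: "finite A" "A \<subseteq> topspace X" for A
  proof -
    have "\<exists>U. openin X U \<and> a \<in> U \<and> eventually (\<lambda>y. y \<notin> U) F" if "a \<in> A" for a
      using kappa_Cauchy_cluster[OF cr F, of a] non A that by (auto simp: frequently_def)
    then obtain U where U: "\<And>a. a \<in> A \<Longrightarrow> openin X (U a) \<and> a \<in> U a \<and> eventually (\<lambda>y. y \<notin> U a) F"
      by metis
    have opU: "openin X (\<Union>(U ` A))"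
      using U by auto
    have "disjnt A (topspace X - \<Union>(U ` A))"
      using U by (auto simp: disjnt_def)
    then obtain f where f: "continuous_map X euclideanreal f"
      "f ` (topspace X - \<Union>(U ` A)) \<subseteq> {1::real}" "f ` A \<subseteq> {0}"
      using Urysohn_completely_regular_compact_closed_alt[OF cr finite_imp_compactin[OF A(2,1)]
          closedin_diff[OF closedin_topspace opU]] by metis
    define g where "g = restrict f (topspace X)"
    have "g \<in> topspace (Cp X)"
      unfolding g_def using f(1) by (rule restrict_in_Cp)
    moreover have "eventually (\<lambda>y. \<forall>a\<in>A. y \<notin> U a) F"
      using U A by (intro eventually_ball_finite) auto
    with evX have "eventually (\<lambda>x. g x = 1) F"
      by eventually_elim (use f(2) in \<open>force simp: g_def\<close>)
    ultimately show ?thesis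
      using f(3) A by (intro bexI[of _ g]) (auto simp: g_def topspace_Cp)
  qed
  then obtain g where g: "\<And>A. finite A \<Longrightarrow> A \<subseteq> topspace X \<Longrightarrow>
      g A \<in> topspace (Cp X) \<and> (\<forall>x\<in>A. g A x = 0) \<and> eventually (\<lambda>x. g A x = 1) F"
    by metis
  define z where "z = restrict (\<lambda>x. 0::real) (topspace X)"
  have zC: "z \<in> topspace (Cp X)"
    unfolding z_def by (intro restrict_in_Cp) simp
  have "limitin (Cp X) g z (finite_subsets_at_top (topspace X))"
    by (rule limitin_finite_subsets_Cp) (use g zC in \<open>auto simp: z_def\<close>)
  from continuous_map_limit[OF lam this]
  have "((\<lambda>A. Lim F (g A)) \<longlongrightarrow> Lim F z) (finite_subsets_at_top (topspace X))"
    by (simp add: o_def)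
  moreover have "eventually (\<lambda>x. z x = 0) F"
    using evX by eventually_elim (simp add: z_def)
  then have "Lim F z = 0"
    by (intro tendsto_Lim[OF nb] tendsto_eventually)
  moreover have "eventually (\<lambda>A. Lim F (g A) = 1) (finite_subsets_at_top (topspace X))"
    by (rule eventually_finite_subsets_at_top_weakI) (use nb g in \<open>auto intro!: tendsto_Lim tendsto_eventually\<close>)
  ultimately have "((\<lambda>A. 1::real) \<longlongrightarrow> 0) (finite_subsets_at_top (topspace X))"
    using tendsto_cong by fastforce
  then show False
    by (simp add: tendsto_const_iff)
qed

section \<open>Metrizable spaces\<close>

lemma continuous_map_dominated_pseudometric:
  fixes d :: "'a \<Rightarrow> 'a \<Rightarrow> real" and f :: "'a \<Rightarrow> real"
  assumes d0: "\<And>x. x \<in> topspace X \<Longrightarrow> d x x = 0"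
    and dcont: "\<And>x. x \<in> topspace X \<Longrightarrow> continuous_map X euclideanreal (d x)"
    and f: "\<And>x y. x \<in> topspace X \<Longrightarrow> y \<in> topspace X \<Longrightarrow> \<bar>f x - f y\<bar> \<le> d x y"
  shows "continuous_map X euclideanreal f"
  unfolding continuous_map_atin
proof
  fix x assume x: "x \<in> topspace X"
  have "eventually (\<lambda>y. y \<in> topspace X) (atin X x)"
    by (auto simp: eventually_atin)
  then have "eventually (\<lambda>y. norm (f y - f x) \<le> d x y) (atin X x)"
    by eventually_elim (use f[OF x] in \<open>simp add: abs_minus_commute\<close>)
  moreover have "(d x \<longlongrightarrow> 0) (atin X x)"
    using dcont[OF x] x d0[OF x] by (auto simp: continuous_map_atin)
  ultimately have "((\<lambda>y. f y - f x) \<longlongrightarrow> 0) (atin X x)"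
    by (rule Lim_null_comparison)
  then show "limitin euclideanreal f (f x) (atin X x)"
    by (simp add: LIM_zero_iff)
qed

text \<open>A \<open>\<kappa>\<close>-Cauchy filter contains balls of arbitrarily small radius for each continuous pseudometric.\<close>

lemma kappa_Cauchy_pseudometric:
  fixes X :: "'a topology" and d :: "'a \<Rightarrow> 'a \<Rightarrow> real"
  assumes F: "kappa_Cauchy X F" and \<epsilon>: "\<epsilon> > 0"
    and d0: "\<And>x. x \<in> topspace X \<Longrightarrow> d x x = 0"
    and dnn: "\<And>x y. x \<in> topspace X \<Longrightarrow> y \<in> topspace X \<Longrightarrow> 0 \<le> d x y"
    and dcom: "\<And>x y. x \<in> topspace X \<Longrightarrow> y \<in> topspace X \<Longrightarrow> d x y = d y x"
    and dtri: "\<And>x y z. x \<in> topspace X \<Longrightarrow> y \<in> topspace X \<Longrightarrow> z \<in> topspace X \<Longrightarrow> d x z \<le> d x y + d y z"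
    and dcont: "\<And>x. x \<in> topspace X \<Longrightarrow> continuous_map X euclideanreal (d x)"
  shows "\<exists>a\<in>topspace X. eventually (\<lambda>x. d a x < \<epsilon>) F"
proof -
  let ?S = "topspace X"
  have nb: "F \<noteq> bot" and evX: "eventually (\<lambda>x. x \<in> ?S) F"
    using F by (auto simp: kappa_Cauchy_def)
  obtain x0 where x0: "x0 \<in> ?S"
    using eventually_happens'[OF nb evX] by blast
  have Lip: "continuous_map X euclideanreal f"
    if "\<And>x y. x \<in> ?S \<Longrightarrow> y \<in> ?S \<Longrightarrow> \<bar>f x - f y\<bar> \<le> d x y" for f
    using d0 dcont that by (rule continuous_map_dominated_pseudometric)
  \<comment> \<open>the \<open>1\<close>-Lipschitz functions into the unit interval, a closed subset of a compact cube\<close>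
  define K where "K = {f \<in> PiE ?S (\<lambda>_. {0..1::real}). \<forall>x\<in>?S. \<forall>y\<in>?S. \<bar>f x - f y\<bar> \<le> d x y}"
  have K: "compactin (Cp X) K"
  proof -
    have cl: "closedin (powertop_real ?S) {f \<in> topspace (powertop_real ?S). \<bar>f x - f y\<bar> \<in> {..d x y}}"
      if "x \<in> ?S" "y \<in> ?S" for x y
      by (rule closedin_continuous_map_preimage[where Y = euclideanreal])
        (use that in \<open>auto intro!: continuous_map_real_abs continuous_map_diff continuous_map_product_projection\<close>)
    have "closedin (powertop_real ?S) (\<Inter>x\<in>?S. \<Inter>y\<in>?S. {f \<in> topspace (powertop_real ?S). \<bar>f x - f y\<bar> \<in> {..d x y}})"
      using x0 by (intro closedin_INT cl) auto
    moreover have "compactin (powertop_real ?S) (PiE ?S (\<lambda>_. {0..1::real}))"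
      by (simp add: compactin_PiE)
    ultimately have "compactin (powertop_real ?S)
        ((\<Inter>x\<in>?S. \<Inter>y\<in>?S. {f \<in> topspace (powertop_real ?S). \<bar>f x - f y\<bar> \<in> {..d x y}})
          \<inter> PiE ?S (\<lambda>_. {0..1::real}))"
      by (rule closed_Int_compactin)
    also have "((\<Inter>x\<in>?S. \<Inter>y\<in>?S. {f \<in> topspace (powertop_real ?S). \<bar>f x - f y\<bar> \<in> {..d x y}})
          \<inter> PiE ?S (\<lambda>_. {0..1::real})) = K"
      using x0 by (auto simp: K_def PiE_def)
    finally show ?thesis
      using Lip by (auto simp: Cp_def compactin_subtopology K_def)
  qed
  \<comment> \<open>the truncated distance from a finite set; the point \<open>x0\<close> keeps the minimum over a nonempty set\<close>
  define g where "g A = restrict (\<lambda>x. Min ((\<lambda>a. min 1 (d a x)) ` insert x0 A)) ?S" for A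
  have gK: "g A \<in> K" if A: "finite A" "A \<subseteq> ?S" for A
  proof -
    have "Min ((\<lambda>a. min 1 (d a x)) ` insert x0 A) \<le> Min ((\<lambda>a. min 1 (d a y)) ` insert x0 A) + d x y"
      if xy: "x \<in> ?S" "y \<in> ?S" for x y
    proof -
      have "Min ((\<lambda>a. min 1 (d a y)) ` insert x0 A) \<in> (\<lambda>a. min 1 (d a y)) ` insert x0 A"
        using A by (intro Min_in) auto
      then obtain a where a: "a \<in> insert x0 A" "Min ((\<lambda>a. min 1 (d a y)) ` insert x0 A) = min 1 (d a y)"
        by blast
      have aS: "a \<in> ?S" using a A x0 by auto
      have "Min ((\<lambda>a. min 1 (d a x)) ` insert x0 A) \<le> min 1 (d a x)"
        using A a by (intro Min_le) auto
      also have "\<dots> \<le> min 1 (d a y) + d x y"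
        using dtri[OF aS xy(2,1)] dcom[OF xy] dnn[OF xy] by linarith
      finally show ?thesis using a by simp
    qed
    note 1 = this
    have 2: "0 \<le> Min ((\<lambda>a. min 1 (d a x)) ` insert x0 A)" "Min ((\<lambda>a. min 1 (d a x)) ` insert x0 A) \<le> 1"
      if "x \<in> ?S" for x
    proof -
      show "0 \<le> Min ((\<lambda>a. min 1 (d a x)) ` insert x0 A)"
        using A x0 dnn that by (subst Min_ge_iff) auto
      have "Min ((\<lambda>a. min 1 (d a x)) ` insert x0 A) \<le> min 1 (d x0 x)"
        using A by (intro Min_le) auto
      then show "Min ((\<lambda>a. min 1 (d a x)) ` insert x0 A) \<le> 1" by simp
    qed
    have "\<bar>g A x - g A y\<bar> \<le> d x y" if xy: "x \<in> ?S" "y \<in> ?S" for x y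
      using 1[OF xy] 1[OF xy(2,1)] dcom[OF xy] xy by (simp add: g_def abs_le_iff)
    then show ?thesis
      using 2 by (auto simp: K_def g_def)
  qed
  have KC: "f \<in> topspace (Cp X)" if "f \<in> K" for f
    using that K compactin_subset_topspace by blast
  define z where "z = restrict (\<lambda>x. 0::real) ?S"
  have zK: "z \<in> K"
    using dnn by (auto simp: K_def z_def)
  have "limitin (Cp X) g z (finite_subsets_at_top ?S)"
  proof (rule limitin_finite_subsets_Cp)
    fix A x assume A: "finite A" "A \<subseteq> ?S" "x \<in> A"
    have "Min ((\<lambda>a. min 1 (d a x)) ` insert x0 A) \<le> min 1 (d x x)"
      using A by (intro Min_le) auto
    then have "g A x \<le> min 1 (d x x)"
      using A by (auto simp: g_def)
    moreover have "0 \<le> g A x"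
      using gK[OF A(1,2)] A by (auto simp: K_def PiE_def Pi_def)
    ultimately show "g A x = z x"
      using A d0 by (auto simp: z_def)
  qed (use gK zK KC in auto)
  then have "limitin (subtopology (Cp X) K) g z (finite_subsets_at_top ?S)"
    using gK zK by (auto simp: limitin_subtopology intro: eventually_finite_subsets_at_top_weakI)
  moreover have "continuous_map (subtopology (Cp X) K) euclideanreal (Lim F)"
    using F K by (simp add: kappa_Cauchy_def)
  ultimately have "limitin euclideanreal (Lim F \<circ> g) (Lim F z) (finite_subsets_at_top ?S)"
    by (rule continuous_map_limit[rotated])
  moreover have "eventually (\<lambda>x. z x = 0) F"
    using evX by eventually_elim (simp add: z_def)
  then have "Lim F z = 0"
    by (intro tendsto_Lim[OF nb] tendsto_eventually)
  ultimately have "((\<lambda>A. Lim F (g A)) \<longlongrightarrow> 0) (finite_subsets_at_top ?S)"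
    by (simp add: o_def)
  \<comment> \<open>the bound is at most \<open>1\<close>, so that the truncation at \<open>1\<close> has no effect\<close>
  then have "eventually (\<lambda>A. Lim F (g A) < min 1 (\<epsilon>/2)) (finite_subsets_at_top ?S)"
    by (rule order_tendstoD(2)) (use \<epsilon> in auto)
  then obtain A where A: "finite A" "A \<subseteq> ?S" "Lim F (g A) < min 1 (\<epsilon>/2)"
    unfolding eventually_finite_subsets_at_top by blast
  have "(g A \<longlongrightarrow> Lim F (g A)) F"
    using F KC[OF gK[OF A(1,2)]] by (simp add: kappa_Cauchy_def topspace_Cp)
  then have "eventually (\<lambda>x. g A x < min 1 (\<epsilon>/2)) F"
    using A(3) by (rule order_tendstoD(2))
  with evX have "eventually (\<lambda>x. \<exists>a\<in>insert x0 A. d a x < \<epsilon>/2) F"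
  proof eventually_elim
    case (elim x)
    have "Min ((\<lambda>a. min 1 (d a x)) ` insert x0 A) \<in> (\<lambda>a. min 1 (d a x)) ` insert x0 A"
      using A by (intro Min_in) auto
    then obtain a where "a \<in> insert x0 A" "g A x = min 1 (d a x)"
      using elim by (auto simp: g_def simp del: Min_insert image_insert)
    then show ?case using elim by (intro bexI[of _ a]) auto
  qed
  then have ev: "eventually (\<lambda>x. \<exists>a\<in>insert x0 A. d a x < \<epsilon>/2) F" .
  have "\<exists>a\<in>insert x0 A. frequently (\<lambda>x. d a x < \<epsilon>/2) F"
  proof (rule ccontr)
    assume "\<not> ?thesis"
    then have "eventually (\<lambda>x. \<forall>a\<in>insert x0 A. \<not> d a x < \<epsilon>/2) F"
      using A by (intro eventually_ball_finite) (auto simp: frequently_def)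
    with ev have "eventually (\<lambda>x. False) F"
      by eventually_elim auto
    then show False using nb by simp
  qed
  then obtain a where a: "a \<in> insert x0 A" "frequently (\<lambda>x. d a x < \<epsilon>/2) F"
    by blast
  have aS: "a \<in> ?S" using a A x0 by auto
  have lim: "(d a \<longlongrightarrow> Lim F (d a)) F"
    using F dcont[OF aS] by (simp add: kappa_Cauchy_def)
  have "Lim F (d a) \<le> \<epsilon>/2"
  proof (rule ccontr)
    assume "\<not> ?thesis"
    then have "eventually (\<lambda>x. d a x > \<epsilon>/2) F"
      by (intro order_tendstoD(1)[OF lim]) simp
    from frequently_eventually_conj[OF a(2) this] show False
      by (auto dest!: frequently_ex)
  qed
  then have "eventually (\<lambda>x. d a x < \<epsilon>) F"
    using \<epsilon> by (intro order_tendstoD(2)[OF lim]) simp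
  then show ?thesis using aS by blast
qed

lemma kappa_complete_metrizable:
  assumes "metrizable_space X"
  shows "kappa_complete X"
proof -
  obtain M d where Md: "Metric_space M d" and X: "X = Metric_space.mtopology M d"
    using assms by (auto simp: metrizable_space_def)
  interpret Metric_space M d by (rule Md)
  have top: "topspace X = M"
    by (simp add: X)
  have dc: "continuous_map X euclideanreal (d x)" if "x \<in> M" for x
    using continuous_on_mdist[of x "metric (M, d)"] that by (simp add: X mtopology_of_def)
  have Lip: "continuous_map X euclideanreal f"
    if "\<And>x y. x \<in> M \<Longrightarrow> y \<in> M \<Longrightarrow> \<bar>f x - f y\<bar> \<le> d x y" for f :: "'a \<Rightarrow> real"
    by (rule continuous_map_dominated_pseudometric[where d = d]) (use dc that in \<open>auto simp: top\<close>)
  show ?thesis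
    unfolding kappa_complete_def
  proof (intro strip)
    fix F assume F: "kappa_Cauchy X F"
    then have nb: "F \<noteq> bot" and evX: "eventually (\<lambda>x. x \<in> M) F"
      and lim: "\<And>f. continuous_map X euclideanreal f \<Longrightarrow> (f \<longlongrightarrow> Lim F f) F"
      by (auto simp: kappa_Cauchy_def top)
    \<comment> \<open>the distance to the limit that \<open>F\<close>, being a Cauchy filter, has in the completion\<close>
    define D where "D x = Lim F (d x)" for x
    have limD: "(d x \<longlongrightarrow> D x) F" if "x \<in> M" for x
      unfolding D_def using dc[OF that] by (rule lim)
    have small: "\<exists>a\<in>M. eventually (\<lambda>x. d a x < \<epsilon>) F" if "\<epsilon> > 0" for \<epsilon>
      using kappa_Cauchy_pseudometric[OF F that, of d] dc triangle by (auto simp: top commute)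
    have Dtri: "D x \<le> d x y + D y" if "x \<in> M" "y \<in> M" for x y
    proof (rule tendsto_le[OF nb _ limD[OF that(1)]])
      show "((\<lambda>z. d x y + d y z) \<longlongrightarrow> d x y + D y) F"
        by (intro tendsto_intros limD that)
      show "eventually (\<lambda>z. d x z \<le> d x y + d y z) F"
        using evX by eventually_elim (use that triangle in auto)
    qed
    have Dc: "continuous_map X euclideanreal D"
    proof (rule Lip)
      show "\<bar>D x - D y\<bar> \<le> d x y" if "x \<in> M" "y \<in> M" for x y
        using Dtri[OF that] Dtri[OF that(2,1)] commute[of x y] by simp
    qed
    have Dnn: "0 \<le> D x" if "x \<in> M" for x
      using tendsto_lowerbound[OF limD[OF that] _ nb] by simp
    have "(D \<longlongrightarrow> 0) F"
    proof (rule tendstoI)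
      fix \<epsilon> :: real assume "\<epsilon> > 0"
      then obtain a where a: "a \<in> M" "eventually (\<lambda>x. d a x < \<epsilon>/3) F"
        using small[of "\<epsilon>/3"] by auto
      have Da: "D a \<le> \<epsilon>/3"
        by (rule tendsto_upperbound[OF limD[OF a(1)] _ nb]) (use a(2) in \<open>auto elim: eventually_mono\<close>)
      show "eventually (\<lambda>x. dist (D x) 0 < \<epsilon>) F"
        using evX a(2)
      proof eventually_elim
        case (elim x)
        then show ?case
          using Da Dtri[OF elim(1) a(1)] Dnn[OF elim(1)] commute[of a x] \<open>\<epsilon> > 0\<close> by simp
      qed
    qed
    \<comment> \<open>otherwise \<open>1/D\<close> would be a continuous function without a limit along \<open>F\<close>\<close>
    moreover have "\<exists>x\<in>M. D x = 0"
    proof (rule ccontr)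
      assume "\<not> ?thesis"
      then have nz: "\<And>x. x \<in> M \<Longrightarrow> D x \<noteq> 0" by blast
      then have "continuous_map X euclideanreal (\<lambda>x. inverse (D x))"
        using Dc by (intro continuous_map_real_inverse) (auto simp: top)
      from tendsto_mult[OF \<open>(D \<longlongrightarrow> 0) F\<close> lim[OF this]]
      have "((\<lambda>x. D x * inverse (D x)) \<longlongrightarrow> 0) F" by simp
      moreover have "eventually (\<lambda>x. D x * inverse (D x) = 1) F"
        using evX by eventually_elim (simp add: nz)
      ultimately have "((\<lambda>x. 1::real) \<longlongrightarrow> 0) F"
        using tendsto_cong by fastforce
      then show False using nb by (simp add: tendsto_const_iff)
    qed
    then obtain x where x: "x \<in> M" "D x = 0" by blast
    have "limitin X (\<lambda>x. x) x F"
      unfolding X limitin_metric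
    proof (intro conjI allI impI x(1))
      fix \<epsilon> :: real assume "\<epsilon> > 0"
      then have "eventually (\<lambda>y. d x y < \<epsilon>) F"
        using order_tendstoD(2)[OF limD[OF x(1)]] x by simp
      with evX show "eventually (\<lambda>y. y \<in> M \<and> d y x < \<epsilon>) F"
        by eventually_elim (simp add: commute)
    qed
    then show "\<exists>l. limitin X (\<lambda>x. x) l F" by blast
  qed
qed

section \<open>Dieudonne complete spaces\<close>

text \<open>\<^term>\<open>chain S w x y s\<close> says that some finite chain of points of \<^term>\<open>S\<close> leads from \<^term>\<open>x\<close> to \<^term>\<open>y\<close> and has
  total weight \<^term>\<open>s\<close>, a step from \<open>u\<close> to \<open>v\<close> having weight \<open>w u v\<close>.\<close>

inductive chain :: "'a set \<Rightarrow> ('a \<Rightarrow> 'a \<Rightarrow> real) \<Rightarrow> 'a \<Rightarrow> 'a \<Rightarrow> real \<Rightarrow> bool" for S w where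
  chain_refl: "x \<in> S \<Longrightarrow> chain S w x x 0"
| chain_step: "chain S w x y s \<Longrightarrow> z \<in> S \<Longrightarrow> chain S w x z (s + w y z)"

lemma chain_in: "chain S w x y s \<Longrightarrow> x \<in> S \<and> y \<in> S"
  by (induction rule: chain.induct) auto

lemma chain_edge: "x \<in> S \<Longrightarrow> y \<in> S \<Longrightarrow> chain S w x y (w x y)"
  using chain_step[OF chain_refl, of x S y w] by simp

lemma chain_trans:
  assumes "chain S w y z t" "chain S w x y s"
  shows "chain S w x z (s + t)"
  using assms
proof (induction rule: chain.induct)
  case (chain_step y y' t z)
  then show ?case
    using chain.chain_step[of S w x y' "s + t" z] by (simp add: add.assoc)
qed simp

lemma chain_sym:
  assumes "chain S w x y s" "\<And>x y. w x y = w y x"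
  shows "chain S w y x s"
  using assms
proof (induction rule: chain.induct)
  case (chain_step x y s z)
  then have "chain S w z y (w y z)"
    using chain_edge[of z S y w] chain_in[OF chain_step.hyps(1)] by simp
  from chain_trans[OF chain_step.IH[OF chain_step.prems] this]
  show ?case by (simp add: add.commute)
qed (rule chain_refl)

lemma chain_nonneg:
  assumes "chain S w x y s" "\<And>x y. w x y \<ge> 0"
  shows "s \<ge> 0"
  using assms by (induction rule: chain.induct) auto

lemma chain_path:
  assumes "chain S w x y s"
  shows "\<exists>p (k::nat). p 0 = x \<and> p k = y \<and> (\<forall>i\<le>k. p i \<in> S) \<and> s = (\<Sum>l=0..<k. w (p l) (p (Suc l)))"
  using assms
proof (induction rule: chain.induct)
  case (chain_refl x)
  then show ?case
    by (intro exI[of _ "\<lambda>_. x"] exI[of _ 0]) simp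
next
  case (chain_step x y s z)
  then obtain p and k :: nat where p: "p 0 = x" "p k = y" "\<forall>i\<le>k. p i \<in> S"
    "s = (\<Sum>l=0..<k. w (p l) (p (Suc l)))"
    by blast
  have "(\<Sum>l=0..<k. w ((p(Suc k := z)) l) ((p(Suc k := z)) (Suc l))) = s"
    unfolding p(4) by (rule sum.cong) auto
  then show ?case
    using p chain_step.hyps
    by (intro exI[of _ "p(Suc k := z)"] exI[of _ "Suc k"]) (auto simp: le_Suc_eq)
qed

text \<open>The combinatorial core of the metrization lemma for uniformities: a chain of weight less than \<open>(1/2)^(n+1)\<close>
  has its end points in \<open>V n\<close>.  Induction on the number of steps: the chain is cut at a step such that
  the parts before and after it have at most half of the weight each.\<close>

lemma path_in_entourage:
  fixes V :: "nat \<Rightarrow> 'a \<Rightarrow> 'a \<Rightarrow> bool" and w :: "'a \<Rightarrow> 'a \<Rightarrow> real" and p :: "nat \<Rightarrow> 'a"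
  assumes w0: "\<And>x y. 0 \<le> w x y"
    and wV: "\<And>n x y. x \<in> S \<Longrightarrow> y \<in> S \<Longrightarrow> w x y < (1/2)^n \<Longrightarrow> V n x y"
    and refl: "\<And>n x. x \<in> S \<Longrightarrow> V n x x"
    and V3: "\<And>n x y z u. V (Suc n) x y \<Longrightarrow> V (Suc n) y z \<Longrightarrow> V (Suc n) z u \<Longrightarrow> V n x u"
    and p: "\<And>l. l \<le> j \<Longrightarrow> p l \<in> S" and ij: "i \<le> j"
    and sum: "(\<Sum>l=i..<j. w (p l) (p (Suc l))) < (1/2)^Suc n"
  shows "V n (p i) (p j)"
  using p ij sum
proof (induction "j - i" arbitrary: i j n rule: less_induct)
  case less
  let ?s = "\<lambda>i j. \<Sum>l=i..<j. w (p l) (p (Suc l))"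
  show ?case
  proof (cases "i = j")
    case True
    then show ?thesis using refl less.prems by simp
  next
    case False
    then have ij: "i < j" using less.prems by simp
    \<comment> \<open>\<open>m\<close> is the first step after which more than half of the weight is used up; the second disjunct
      provides for chains of weight \<open>0\<close>, for which there is no such step\<close>
    define P where "P m \<longleftrightarrow> i \<le> m \<and> (?s i j / 2 < ?s i (Suc m) \<or> Suc m = j)" for m
    define m where "m = (LEAST m. P m)"
    have Pj: "P (j - 1)"
      using ij by (simp add: P_def)
    have Pm: "P m"
      unfolding m_def using Pj by (rule LeastI)
    have mj: "m < j"
      using Least_le[of P, OF Pj] ij by (simp add: m_def)
    have im: "i \<le> m" using Pm by (simp add: P_def)
    have s0: "0 \<le> ?s a b" for a b
      by (intro sum_nonneg w0)
    have left: "?s i m \<le> ?s i j / 2"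
    proof (cases "m = i")
      case True
      then show ?thesis using s0[of i j] by simp
    next
      case False
      then have "\<not> P (m - 1)"
        using not_less_Least[of "m - 1" P] im by (simp add: m_def[symmetric])
      moreover have "i \<le> m - 1" "Suc (m - 1) = m"
        using False im by auto
      ultimately show ?thesis
        by (simp add: P_def not_less)
    qed
    have split: "?s i j = ?s i (Suc m) + ?s (Suc m) j"
      using im mj by (intro sum.atLeastLessThan_concat[symmetric]) auto
    have right: "?s (Suc m) j \<le> ?s i j / 2"
    proof (cases "Suc m = j")
      case True
      then show ?thesis using s0[of i j] by simp
    next
      case False
      then have "?s i j / 2 < ?s i (Suc m)" using Pm unfolding P_def by blast
      then show ?thesis using split by linarith
    qed
    have "?s i (Suc m) = ?s i m + w (p m) (p (Suc m))"
      using im by simp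
    then have mid: "w (p m) (p (Suc m)) \<le> ?s i j"
      using split s0[of i m] s0[of "Suc m" j] by linarith
    have "V (Suc n) (p i) (p m)"
      by (rule less.hyps) (use left less.prems im mj in auto)
    moreover have "V (Suc n) (p m) (p (Suc m))"
      by (rule wV) (use mid less.prems mj in auto)
    moreover have "V (Suc n) (p (Suc m)) (p j)"
      by (rule less.hyps) (use right less.prems im mj in auto)
    ultimately show ?thesis
      by (rule V3)
  qed
qed

text \<open>Each entourage of a uniformity contains one that is given by a uniformly continuous pseudometric.\<close>

lemma uniformity_on_pseudometric:
  fixes S :: "'a set"
  assumes U: "uniformity_on S \<Phi>" and E: "eventually E \<Phi>"
  obtains d :: "'a \<Rightarrow> 'a \<Rightarrow> real" and \<delta> :: real where
    "\<And>x. x \<in> S \<Longrightarrow> d x x = 0" "\<And>x y. x \<in> S \<Longrightarrow> y \<in> S \<Longrightarrow> 0 \<le> d x y" "\<And>x y. d x y = d y x"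
    "\<And>x y z. x \<in> S \<Longrightarrow> y \<in> S \<Longrightarrow> z \<in> S \<Longrightarrow> d x z \<le> d x y + d y z"
    "\<And>\<epsilon>. \<epsilon> > 0 \<Longrightarrow> eventually (\<lambda>(x, y). d x y < \<epsilon>) \<Phi>"
    "\<delta> > 0" "\<And>x y. x \<in> S \<Longrightarrow> y \<in> S \<Longrightarrow> d x y < \<delta> \<Longrightarrow> E (x, y)"
proof -
  have evS: "eventually (\<lambda>p. p \<in> S \<times> S) \<Phi>"
    and refl: "\<And>E x. eventually E \<Phi> \<Longrightarrow> x \<in> S \<Longrightarrow> E (x, x)"
    and sym: "\<And>E. eventually E \<Phi> \<Longrightarrow> eventually (\<lambda>(x, y). E (y, x)) \<Phi>"
    and half: "\<And>E. eventually E \<Phi> \<Longrightarrow> \<exists>D. eventually D \<Phi> \<and> (\<forall>x y z. D (x, y) \<longrightarrow> D (y, z) \<longrightarrow> E (x, z))"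
    using U unfolding uniformity_on_def by blast+
  \<comment> \<open>the symmetric entourages contained in \<open>S \<times> S\<close>\<close>
  define good where "good D \<longleftrightarrow> eventually D \<Phi> \<and> (\<forall>x y. D (x, y) \<longrightarrow> D (y, x) \<and> x \<in> S \<and> y \<in> S)" for D
  have third: "\<exists>D. good D \<and> (\<forall>x y z u. D (x, y) \<longrightarrow> D (y, z) \<longrightarrow> D (z, u) \<longrightarrow> E (x, u))"
    if E: "eventually E \<Phi>" for E
  proof -
    obtain D1 where D1: "eventually D1 \<Phi>" "\<And>x y z. D1 (x, y) \<Longrightarrow> D1 (y, z) \<Longrightarrow> E (x, z)"
      using half[OF E] by blast
    obtain D2 where D2: "eventually D2 \<Phi>" "\<And>x y z. D2 (x, y) \<Longrightarrow> D2 (y, z) \<Longrightarrow> D1 (x, z)"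
      using half[OF D1(1)] by blast
    define D where "D = (\<lambda>(x, y). D2 (x, y) \<and> D2 (y, x) \<and> x \<in> S \<and> y \<in> S)"
    have "eventually D \<Phi>"
      using D2(1) sym[OF D2(1)] evS by eventually_elim (auto simp: D_def)
    moreover have "E (x, u)" if "D (x, y)" "D (y, z)" "D (z, u)" for x y z u
      using D1(2)[OF D2(2)[of x y z] D2(2)[of z u u]] that refl[OF D2(1)] by (simp add: D_def)
    ultimately show ?thesis
      by (intro exI[of _ D]) (auto simp: good_def D_def)
  qed
  obtain V0 where V0: "good V0" "\<And>x y z u. V0 (x, y) \<Longrightarrow> V0 (y, z) \<Longrightarrow> V0 (z, u) \<Longrightarrow> E (x, u)"
    using third[OF E] by blast
  define nxt where
    "nxt E = (SOME D. good D \<and> (\<forall>x y z u. D (x, y) \<longrightarrow> D (y, z) \<longrightarrow> D (z, u) \<longrightarrow> E (x, u)))" for E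
  have nxt: "good (nxt E) \<and> (\<forall>x y z u. nxt E (x, y) \<longrightarrow> nxt E (y, z) \<longrightarrow> nxt E (z, u) \<longrightarrow> E (x, u))"
    if "good E" for E
    unfolding nxt_def by (rule someI_ex[OF third]) (use that in \<open>simp add: good_def\<close>)
  define V where "V n = (nxt ^^ n) V0" for n
  have V00: "V 0 = V0" and VS: "V (Suc n) = nxt (V n)" for n
    by (simp_all add: V_def)
  have good: "good (V n)" for n
    by (induction n) (simp_all add: V00 VS V0(1) nxt)
  have V3: "V n (x, u)" if "V (Suc n) (x, y)" "V (Suc n) (y, z)" "V (Suc n) (z, u)" for n x y z u
    using nxt[OF good[of n]] that unfolding VS by blast
  have Vrefl: "V n (x, x)" if "x \<in> S" for n x
    using refl[of "V n"] good[of n] that by (simp add: good_def)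
  have dec: "V n (x, y)" if "V (Suc n) (x, y)" for n x y
    using V3[of n x x x y] V3[of n x y y y] that good[of "Suc n"] Vrefl by (auto simp: good_def)
  have dec': "V m (x, y)" if "V n (x, y)" "m \<le> n" for m n x y
    using that(2,1) by (induction rule: inc_induct) (auto intro: dec)
  \<comment> \<open>the weight is chosen such that \<open>w x y < (1/2)^n\<close> if and only if \<open>V n (x, y)\<close>\<close>
  define w :: "'a \<Rightarrow> 'a \<Rightarrow> real" where
    "w x y = (if \<forall>n. V n (x, y) then 0 else (1/2) ^ (LEAST n. \<not> V n (x, y)))" for x y
  have w0: "0 \<le> w x y" for x y
    by (simp add: w_def)
  have wsym: "w x y = w y x" for x y
  proof -
    have "V n (x, y) = V n (y, x)" for n
      using good[of n] by (auto simp: good_def)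
    then show ?thesis by (simp add: w_def)
  qed
  have wV: "V n (x, y)" if "w x y < (1/2)^n" for n x y
  proof (rule ccontr)
    assume n: "\<not> V n (x, y)"
    then have "(LEAST n. \<not> V n (x, y)) \<le> n"
      by (rule Least_le)
    then have "(1/2)^n \<le> (1/2::real) ^ (LEAST n. \<not> V n (x, y))"
      by (intro power_decreasing) auto
    then show False using that n by (auto simp: w_def split: if_splits)
  qed
  have Vw: "w x y < (1/2)^n" if "V n (x, y)" for n x y
  proof (cases "\<forall>n. V n (x, y)")
    case False
    then have "\<not> V (LEAST n. \<not> V n (x, y)) (x, y)"
      using LeastI_ex[of "\<lambda>n. \<not> V n (x, y)"] by blast
    then have "n < (LEAST n. \<not> V n (x, y))"
      using dec'[OF that] not_less by blast
    then have "(1/2::real) ^ (LEAST n. \<not> V n (x, y)) < (1/2)^n"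
      by (intro power_strict_decreasing) auto
    then show ?thesis
      using False by (simp add: w_def)
  qed (simp add: w_def)
  define d where "d x y = Inf {s. chain S w x y s}" for x y
  have bdd: "bdd_below {s. chain S w x y s}" for x y
    by (rule bdd_belowI[of _ 0]) (use chain_nonneg[OF _ w0] in auto)
  have ne: "{s. chain S w x y s} \<noteq> {}" if "x \<in> S" "y \<in> S" for x y
    using chain_edge[OF that] by blast
  have dle: "d x y \<le> s" if "chain S w x y s" for x y s
    unfolding d_def by (rule cInf_lower) (use bdd that in auto)
  have dlt: "\<exists>s. chain S w x y s \<and> s < t" if "x \<in> S" "y \<in> S" "d x y < t" for x y t
    using cInf_lessD[OF ne[OF that(1,2)]] that(3) by (auto simp: d_def)
  show thesis
  proof (rule that[of d "1/2"])
    show nn: "0 \<le> d x y" if "x \<in> S" "y \<in> S" for x y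
      unfolding d_def by (rule cInf_greatest[OF ne[OF that]]) (use chain_nonneg[OF _ w0] in auto)
    show "d x x = 0" if "x \<in> S" for x
      using nn[OF that that] dle[OF chain_refl[OF that]] by simp
    show "d x y = d y x" for x y
    proof -
      have "{s. chain S w x y s} = {s. chain S w y x s}"
        using chain_sym[where S = S and w = w] wsym by blast
      then show ?thesis by (simp add: d_def)
    qed
    show "d x z \<le> d x y + d y z" if xyz: "x \<in> S" "y \<in> S" "z \<in> S" for x y z
    proof (rule field_le_epsilon)
      fix e :: real assume "e > 0"
      then obtain s t where st: "chain S w x y s" "s < d x y + e/2" "chain S w y z t" "t < d y z + e/2"
        using dlt[of x y "d x y + e/2"] dlt[of y z "d y z + e/2"] xyz by auto
      show "d x z \<le> d x y + d y z + e"
        using dle[OF chain_trans[OF st(3,1)]] st by linarith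
    qed
    show "eventually (\<lambda>(x, y). d x y < \<epsilon>) \<Phi>" if \<epsilon>: "\<epsilon> > 0" for \<epsilon>
    proof -
      obtain n where n: "(1/2::real)^n < \<epsilon>"
        using real_arch_pow_inv[OF \<epsilon>, of "1/2"] by auto
      have "eventually (V n) \<Phi>"
        using good[of n] by (simp add: good_def)
      then show ?thesis
        using evS
      proof eventually_elim
        case (elim p)
        then show ?case
          using Vw[of n "fst p" "snd p"] dle[OF chain_edge[of "fst p" S "snd p" w]] n by (cases p) auto
      qed
    qed
    show "E (x, y)" if xy: "x \<in> S" "y \<in> S" "d x y < 1/2" for x y
    proof -
      obtain s where s: "chain S w x y s" "s < 1/2"
        using dlt[OF xy] by blast
      obtain p and k :: nat where p: "p 0 = x" "p k = y" "\<forall>i\<le>k. p i \<in> S"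
        "s = (\<Sum>l=0..<k. w (p l) (p (Suc l)))"
        using chain_path[OF s(1)] by blast
      have "V 0 (p 0, p k)"
        by (rule path_in_entourage[where V = "\<lambda>n x y. V n (x, y)" and w = w and S = S])
          (use w0 wV Vrefl V3 p s in auto)
      then show ?thesis
        using V0(2)[of x y y y] Vrefl[of y 0] p xy by (simp add: V00)
    qed
  qed simp
qed

lemma kappa_complete_Dieudonne:
  assumes "Dieudonne_complete_space X"
  shows "kappa_complete X"
  unfolding kappa_complete_def
proof (intro strip)
  fix F assume F: "kappa_Cauchy X F"
  then have nb: "F \<noteq> bot" and evX: "eventually (\<lambda>x. x \<in> topspace X) F"
    by (auto simp: kappa_Cauchy_def)
  obtain \<Phi> where \<Phi>: "compatible_uniformity X \<Phi>"
    and complete: "\<forall>F. F \<noteq> bot \<longrightarrow> F \<times>\<^sub>F F \<le> \<Phi> \<longrightarrow> (\<exists>l. limitin X (\<lambda>x. x) l F)"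
    using assms by (auto simp: Dieudonne_complete_space_def)
  have U: "uniformity_on (topspace X) \<Phi>"
    using \<Phi> by (simp add: compatible_uniformity_def)
  have op: "openin X U \<longleftrightarrow>
        U \<subseteq> topspace X \<and> (\<forall>x\<in>U. eventually (\<lambda>(x', y). x' = x \<longrightarrow> y \<in> U) \<Phi>)" for U
    using \<Phi> unfolding compatible_uniformity_def by (elim conjE allE)
  have "F \<times>\<^sub>F F \<le> \<Phi>"
  proof (rule filter_leI)
    fix E assume E: "eventually E \<Phi>"
    obtain d :: "'a \<Rightarrow> 'a \<Rightarrow> real" and \<delta> :: real where
      d: "\<And>x. x \<in> topspace X \<Longrightarrow> d x x = 0" "\<And>x y. x \<in> topspace X \<Longrightarrow> y \<in> topspace X \<Longrightarrow> 0 \<le> d x y" 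
        "\<And>x y. d x y = d y x"
        "\<And>x y z. x \<in> topspace X \<Longrightarrow> y \<in> topspace X \<Longrightarrow> z \<in> topspace X \<Longrightarrow> d x z \<le> d x y + d y z"
      and dU: "\<And>\<epsilon>. \<epsilon> > 0 \<Longrightarrow> eventually (\<lambda>(x, y). d x y < \<epsilon>) \<Phi>"
      and \<delta>: "\<delta> > 0" "\<And>x y. x \<in> topspace X \<Longrightarrow> y \<in> topspace X \<Longrightarrow> d x y < \<delta> \<Longrightarrow> E (x, y)"
      by (fact uniformity_on_pseudometric[OF U E])
    have dc: "continuous_map X euclideanreal (d x)" if x: "x \<in> topspace X" for x
      unfolding continuous_map_def
    proof (intro conjI allI impI)
      fix U :: "real set" assume "openin euclideanreal U"
      then have "open U" by simp
      show "openin X {y \<in> topspace X. d x y \<in> U}"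
        unfolding op
      proof (intro conjI ballI)
        fix y assume "y \<in> {y \<in> topspace X. d x y \<in> U}"
        then have y: "y \<in> topspace X" "d x y \<in> U" by auto
        then obtain \<epsilon> where \<epsilon>: "\<epsilon> > 0" "\<And>t. dist t (d x y) < \<epsilon> \<Longrightarrow> t \<in> U"
          using \<open>open U\<close> unfolding open_dist by blast
        have "eventually (\<lambda>p. p \<in> topspace X \<times> topspace X) \<Phi>"
          using U by (simp add: uniformity_on_def)
        with dU[OF \<epsilon>(1)]
        show "eventually (\<lambda>(x', z). x' = y \<longrightarrow> z \<in> {y \<in> topspace X. d x y \<in> U}) \<Phi>"
        proof eventually_elim
          case (elim p)
          show ?case
          proof (clarsimp split: prod.split)
            fix z assume "p = (y, z)"
            with elim have z: "z \<in> topspace X" "d y z < \<epsilon>" by auto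
            have "dist (d x z) (d x y) < \<epsilon>"
              using d(4)[OF x y(1) z(1)] d(4)[OF x z(1) y(1)] d(3)[of z y] z(2)
              by (simp add: dist_real_def)
            with \<epsilon> z show "z \<in> topspace X \<and> d x z \<in> U" by blast
          qed
        qed
      qed auto
    qed auto
    obtain a where a: "a \<in> topspace X" "eventually (\<lambda>x. d a x < \<delta>/2) F"
      using kappa_Cauchy_pseudometric[OF F, of "\<delta>/2" d] d dc \<delta>(1) by auto
    have "eventually (\<lambda>x. x \<in> topspace X \<and> d a x < \<delta>/2) F"
      using evX a(2) by (rule eventually_conj)
    then show "eventually E (F \<times>\<^sub>F F)"
      unfolding eventually_prod_filter
    proof (intro exI conjI allI impI)
      fix x y assume "x \<in> topspace X \<and> d a x < \<delta>/2" "y \<in> topspace X \<and> d a y < \<delta>/2"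
      then show "E (x, y)"
        using d(4)[of x a y] d(3)[of a x] a by (intro \<delta>) auto
    qed
  qed
  with nb show "\<exists>l. limitin X (\<lambda>x. x) l F"
    using complete by blast
qed

section \<open>Functionally bounded sets\<close>

text \<open>A family that lies in a compact set eventually along a proper filter has a cluster point there.\<close>

lemma compactin_cluster_point:
  assumes K: "compactin X K" and F: "F \<noteq> bot" and ev: "eventually (\<lambda>t. f t \<in> K) F"
  shows "\<exists>x\<in>K. \<forall>U. openin X U \<and> x \<in> U \<longrightarrow> frequently (\<lambda>t. f t \<in> U) F"
proof (rule ccontr)
  assume non: "\<not> ?thesis"
  define \<U> where "\<U> = {U. openin X U \<and> eventually (\<lambda>t. f t \<notin> U) F}"
  have "K \<subseteq> \<Union>\<U>"
  proof
    fix x assume "x \<in> K"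
    then obtain U where "openin X U" "x \<in> U" "\<not> frequently (\<lambda>t. f t \<in> U) F"
      using non by blast
    then show "x \<in> \<Union>\<U>" by (auto simp: \<U>_def frequently_def)
  qed
  then obtain \<V> where V: "finite \<V>" "\<V> \<subseteq> \<U>" "K \<subseteq> \<Union>\<V>"
    using compactinD[OF K, of \<U>] by (auto simp: \<U>_def)
  have "eventually (\<lambda>t. \<forall>U\<in>\<V>. f t \<notin> U) F"
    using V by (intro eventually_ball_finite) (auto simp: \<U>_def)
  with ev have "eventually (\<lambda>t. False) F"
    by eventually_elim (use V in blast)
  then show False using F by simp
qed

lemma cluster_value_eq_limit:
  fixes f :: "'b \<Rightarrow> real"
  assumes g: "continuous_map X euclideanreal g" and x: "x \<in> topspace X"
    and cl: "\<And>U. openin X U \<Longrightarrow> x \<in> U \<Longrightarrow> frequently (\<lambda>t. h t \<in> U) F"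
    and lim: "((\<lambda>t. g (h t)) \<longlongrightarrow> l) F"
  shows "g x = l"
proof (rule ccontr)
  assume "g x \<noteq> l"
  then obtain U V where UV: "open U" "open V" "g x \<in> U" "l \<in> V" "U \<inter> V = {}"
    using hausdorff[of "g x" l] by metis
  have "openin X {y \<in> topspace X. g y \<in> U}"
    using UV by (intro openin_continuous_map_preimage[OF g]) simp
  then have "frequently (\<lambda>t. h t \<in> {y \<in> topspace X. g y \<in> U}) F"
    by (rule cl) (use x UV in simp)
  moreover have "eventually (\<lambda>t. g (h t) \<in> V) F"
    by (rule topological_tendstoD[OF lim UV(2,4)])
  ultimately have "frequently (\<lambda>t. g (h t) \<in> V \<and> h t \<in> {y \<in> topspace X. g y \<in> U}) F"
    by (rule frequently_eventually_conj)
  then have "frequently (\<lambda>t. False) F"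
    by (rule frequently_elim1) (use UV(5) in blast)
  then show False
    by simp
qed

text \<open>A functionally bounded set cannot lead out of the space as far as countably many functions are concerned:
  if \<open>f n (x m)\<close> tends to \<open>p n\<close> for each \<open>n\<close>, then the values \<open>p n\<close> are attained simultaneously at some point.\<close>

lemma functionally_bounded_common_value:
  fixes f :: "nat \<Rightarrow> 'a \<Rightarrow> real"
  assumes A: "functionally_bounded_in X A" and x: "\<And>m::nat. x m \<in> A"
    and f: "\<And>n. continuous_map X euclideanreal (f n)"
    and lim: "\<And>n. (\<lambda>m. f n (x m)) \<longlonglongrightarrow> p n"
  shows "\<exists>z\<in>topspace X. \<forall>n. f n z = p n"
proof (rule ccontr)
  assume non: "\<not> ?thesis"
  \<comment> \<open>the distance from \<open>p\<close> in the metrizable space of real sequences; it tends to \<open>0\<close> along \<open>x\<close>, so its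
    reciprocal cannot be a continuous function on \<open>X\<close>\<close>
  define D where "D = (\<lambda>z. dist (\<lambda>n. f n z) p)"
  have "continuous_map X (powertop_real UNIV) (\<lambda>z n. f n z)"
    using f by (simp add: continuous_map_componentwise_UNIV)
  then have \<Phi>: "continuous_map X euclidean (\<lambda>z n. f n z)"
    by (simp add: euclidean_product_topology)
  have "continuous_map euclidean euclideanreal (\<lambda>q. dist q p)"
    by (intro continuous_map_iff_continuous2[THEN iffD2] continuous_intros)
  from continuous_map_compose[OF \<Phi> this] have D: "continuous_map X euclideanreal D"
    by (simp add: o_def D_def)
  have Dnz: "D z \<noteq> 0" if "z \<in> topspace X" for z
    using non that by (auto simp: D_def fun_eq_iff)
  then have "continuous_map X euclideanreal (\<lambda>z. inverse (D z))"
    by (intro continuous_map_real_inverse D)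
  then have "bounded ((\<lambda>z. inverse (D z)) ` A)"
    using A by (simp add: functionally_bounded_in_def)
  then obtain B where B: "\<And>z. z \<in> A \<Longrightarrow> \<bar>inverse (D z)\<bar> \<le> B"
    by (auto simp: bounded_iff)
  have "limitin (powertop_real UNIV) (\<lambda>m n. f n (x m)) p sequentially"
    using lim by (simp add: limitin_componentwise)
  then have "(\<lambda>m n. f n (x m)) \<longlonglongrightarrow> p"
    by (simp add: euclidean_product_topology)
  then have D0: "(\<lambda>m. D (x m)) \<longlonglongrightarrow> 0"
    unfolding D_def by (rule tendsto_dist_iff[THEN iffD1])
  have "(\<lambda>m. D (x m) * B) \<longlonglongrightarrow> 0 * B"
    by (intro tendsto_mult D0 tendsto_const)
  then have "eventually (\<lambda>m. D (x m) * B < 1) sequentially"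
    by (intro order_tendstoD(2)) auto
  then obtain m where m: "D (x m) * B < 1"
    by (auto simp: eventually_sequentially)
  have xm: "x m \<in> topspace X"
    using A x by (auto simp: functionally_bounded_in_def)
  have pos: "D (x m) > 0"
    using Dnz[OF xm] by (simp add: D_def)
  have "1 = D (x m) * inverse (D (x m))"
    using pos by simp
  also have "\<dots> \<le> D (x m) * B"
    using B[OF x[of m]] pos by (intro mult_left_mono) auto
  finally show False using m by simp
qed

text \<open>The double limit argument.  If the limit functional fails to be continuous at \<open>f0 \<in> K\<close>, functions \<open>f n \<in> K\<close> and
  points \<open>x n \<in> A\<close> are chosen alternately in such a way that \<open>f n (x m)\<close> tends to \<open>f0 (x m)\<close> as \<open>n\<close> grows and to
  \<open>Lim F (f n)\<close> as \<open>m\<close> grows, while \<open>Lim F (f n)\<close> stays away from \<open>Lim F f0\<close>.  A cluster point \<open>h\<close> of the sequence \<open>f\<close>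
  agrees with \<open>f0\<close> on the points \<open>x m\<close>.  Applied to \<open>f0\<close>, \<open>h\<close> and all the \<open>f n\<close>, the preceding lemma yields a point \<open>z\<close> with
  \<open>h z = Lim F f0\<close> and \<open>f n z = Lim F (f n)\<close>, although \<open>h z\<close> is a cluster value of the \<open>f n z\<close>.\<close>

lemma functionally_bounded_Lim_continuous:
  fixes X :: "'a topology"
  assumes A: "functionally_bounded_in X A" and nb: "F \<noteq> bot" and evA: "eventually (\<lambda>x. x \<in> A) F"
    and lim: "\<And>f. continuous_map X euclideanreal f \<Longrightarrow> (f \<longlongrightarrow> Lim F f) F"
    and K: "compactin (Cp X) K"
  shows "continuous_map (subtopology (Cp X) K) euclideanreal (Lim F)"
proof (rule ccontr)
  assume "\<not> ?thesis"
  then obtain f0 where f0: "f0 \<in> topspace (Cp X)" "f0 \<in> K"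
    and "\<not> (Lim F \<longlongrightarrow> Lim F f0) (atin (subtopology (Cp X) K) f0)"
    by (auto simp: continuous_map_atin)
  then obtain \<epsilon> where \<epsilon>: "\<epsilon> > 0"
    and nev: "\<not> eventually (\<lambda>f. dist (Lim F f) (Lim F f0) < \<epsilon>) (atin (subtopology (Cp X) K) f0)"
    by (auto simp: tendsto_iff)
  have KC: "f \<in> topspace (Cp X)" "continuous_map X euclideanreal f" if "f \<in> K" for f
    using K compactin_subset_topspace that topspace_Cp by blast+
  have AX: "A \<subseteq> topspace X"
    using A by (simp add: functionally_bounded_in_def)
  have ex_f: "\<exists>f. f \<in> K \<and> (\<forall>x\<in>B. \<bar>f x - f0 x\<bar> < \<delta>) \<and> \<epsilon> \<le> dist (Lim F f) (Lim F f0)"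
    if B: "finite B" "B \<subseteq> A" and \<delta>: "\<delta> > 0" for B \<delta>
  proof (rule ccontr)
    assume non: "\<not> ?thesis"
    have "openin (Cp X) {f \<in> topspace (Cp X). \<forall>x\<in>B. f x \<in> ball (f0 x) \<delta>}"
    proof -
      have "openin (Cp X) {f \<in> topspace (Cp X). f x \<in> ball (f0 x) \<delta>}" if "x \<in> B" for x
        using that B AX by (intro openin_continuous_map_preimage[OF Cp_eval]) auto
      then have "openin (Cp X) (topspace (Cp X) \<inter> (\<Inter>x\<in>B. {f \<in> topspace (Cp X). f x \<in> ball (f0 x) \<delta>}))"
        using B by (cases "B = {}") (auto intro!: openin_Int openin_INT)
      moreover have "topspace (Cp X) \<inter> (\<Inter>x\<in>B. {f \<in> topspace (Cp X). f x \<in> ball (f0 x) \<delta>}) =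
          {f \<in> topspace (Cp X). \<forall>x\<in>B. f x \<in> ball (f0 x) \<delta>}"
        by auto
      ultimately show ?thesis by simp
    qed
    then have "openin (subtopology (Cp X) K) (K \<inter> {f \<in> topspace (Cp X). \<forall>x\<in>B. f x \<in> ball (f0 x) \<delta>})"
      by (simp add: openin_subtopology_Int2)
    moreover have "dist (Lim F f) (Lim F f0) < \<epsilon>"
      if "f \<in> K \<inter> {f \<in> topspace (Cp X). \<forall>x\<in>B. f x \<in> ball (f0 x) \<delta>}" for f
      using non that by (auto simp: dist_real_def abs_minus_commute not_le)
    ultimately have "eventually (\<lambda>f. dist (Lim F f) (Lim F f0) < \<epsilon>) (atin (subtopology (Cp X) K) f0)"
      unfolding eventually_atin
      by (intro disjI2 exI[of _ "K \<inter> {f \<in> topspace (Cp X). \<forall>x\<in>B. f x \<in> ball (f0 x) \<delta>}"])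
        (use f0 \<delta> in auto)
    with nev show False ..
  qed
  have ex_x: "\<exists>x. x \<in> A \<and> (\<forall>g\<in>G. \<bar>g x - Lim F g\<bar> < \<delta>)"
    if G: "finite G" "G \<subseteq> K" and \<delta>: "\<delta> > 0" for G \<delta>
  proof -
    have "eventually (\<lambda>x. \<forall>g\<in>G. \<bar>g x - Lim F g\<bar> < \<delta>) F"
      using G \<delta> KC lim by (intro eventually_ball_finite) (auto simp: tendsto_iff dist_real_def)
    with evA have "eventually (\<lambda>x. x \<in> A \<and> (\<forall>g\<in>G. \<bar>g x - Lim F g\<bar> < \<delta>)) F"
      by (rule eventually_conj)
    then show ?thesis
      using eventually_happens'[OF nb] by blast
  qed
  obtain \<phi> where \<phi>: "\<And>B n. finite B \<Longrightarrow> B \<subseteq> A \<Longrightarrow> \<phi> B n \<in> K \<and>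
      (\<forall>x\<in>B. \<bar>\<phi> B n x - f0 x\<bar> < inverse (real (Suc n))) \<and> \<epsilon> \<le> dist (Lim F (\<phi> B n)) (Lim F f0)"
  proof -
    have "\<exists>f. finite B \<longrightarrow> B \<subseteq> A \<longrightarrow> f \<in> K \<and>
      (\<forall>x\<in>B. \<bar>f x - f0 x\<bar> < inverse (real (Suc n))) \<and> \<epsilon> \<le> dist (Lim F f) (Lim F f0)" for B n
      using ex_f[of B "inverse (real (Suc n))"] by (cases "finite B \<and> B \<subseteq> A") auto
    then show thesis using that by metis
  qed
  obtain \<xi> where \<xi>: "\<And>G n. finite G \<Longrightarrow> G \<subseteq> K \<Longrightarrow> \<xi> G n \<in> A \<and>
      (\<forall>g\<in>G. \<bar>g (\<xi> G n) - Lim F g\<bar> < inverse (real (Suc n)))"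
  proof -
    have "\<exists>x. finite G \<longrightarrow> G \<subseteq> K \<longrightarrow> x \<in> A \<and> (\<forall>g\<in>G. \<bar>g x - Lim F g\<bar> < inverse (real (Suc n)))" for G n
      using ex_x[of G "inverse (real (Suc n))"] by (cases "finite G \<and> G \<subseteq> K") auto
    then show thesis using that by metis
  qed
  \<comment> \<open>\<open>B n\<close> and \<open>G n\<close> collect the points and the functions chosen in the first \<open>n\<close> rounds; in each round the function
    precedes the point, so \<open>x n\<close> takes \<open>f n\<close> into account\<close>
  define st where "st = rec_nat ({}, {f0})
    (\<lambda>n (B, G). let G' = insert (\<phi> B n) G in (insert (\<xi> G' n) B, G'))"
  define B where "B n = fst (st n)" for n
  define G where "G n = snd (st n)" for n
  define f where "f n = \<phi> (B n) n" for n
  define x where "x n = \<xi> (G (Suc n)) n" for n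
  have B0: "B 0 = {}" and G0: "G 0 = {f0}"
    by (simp_all add: B_def G_def st_def)
  have GS: "G (Suc n) = insert (f n) (G n)" for n
    by (simp add: B_def G_def st_def f_def case_prod_beta Let_def)
  have BS: "B (Suc n) = insert (x n) (B n)" for n
    using GS[of n] by (simp add: B_def G_def st_def f_def x_def case_prod_beta Let_def)
  have inv: "finite (B n) \<and> B n \<subseteq> A \<and> finite (G n) \<and> G n \<subseteq> K" for n
  proof (induction n)
    case (Suc n)
    then have fK: "f n \<in> K"
      using \<phi>[of "B n" n] by (simp add: f_def)
    then have "x n \<in> A"
      using \<xi>[of "G (Suc n)" n] Suc by (simp add: x_def GS)
    then show ?case
      using Suc fK by (simp add: GS BS)
  qed (use f0 in \<open>simp add: B0 G0\<close>)
  have fK: "f n \<in> K" and f_far: "\<epsilon> \<le> dist (Lim F (f n)) (Lim F f0)"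
    and f_near: "y \<in> B n \<Longrightarrow> \<bar>f n y - f0 y\<bar> < inverse (real (Suc n))" for n y
    using \<phi>[of "B n" n] inv[of n] by (auto simp: f_def)
  have xA: "x n \<in> A" and x_near: "g \<in> G (Suc n) \<Longrightarrow> \<bar>g (x n) - Lim F g\<bar> < inverse (real (Suc n))" for n g
    using \<xi>[of "G (Suc n)" n] inv[of "Suc n"] by (auto simp: x_def)
  have xB: "x m \<in> B n" if "m < n" for m n
    using that by (induction n) (auto simp: BS less_Suc_eq)
  have Gmono: "G m \<subseteq> G n" if "m \<le> n" for m n
    using that by (induction rule: dec_induct) (auto simp: GS)
  have inv0: "(\<lambda>n. inverse (real (Suc n))) \<longlonglongrightarrow> 0"
    by (rule LIMSEQ_inverse_real_of_nat)
  have lim_x: "(\<lambda>m. g (x m)) \<longlonglongrightarrow> Lim F g" if "g \<in> G n" for g n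
  proof -
    have "eventually (\<lambda>m. norm (g (x m) - Lim F g) \<le> inverse (real (Suc m))) sequentially"
    proof (rule eventually_sequentiallyI)
      fix m assume "n \<le> m"
      then have "g \<in> G (Suc m)"
        using Gmono[of n "Suc m"] that by auto
      then show "norm (g (x m) - Lim F g) \<le> inverse (real (Suc m))"
        using x_near[of g m] by simp
    qed
    then have "(\<lambda>m. g (x m) - Lim F g) \<longlonglongrightarrow> 0"
      using inv0 by (rule Lim_null_comparison)
    then show ?thesis
      by (rule LIM_zero_cancel)
  qed
  have lim_f: "(\<lambda>n. f n (x m)) \<longlonglongrightarrow> f0 (x m)" for m
  proof -
    have "eventually (\<lambda>n. norm (f n (x m) - f0 (x m)) \<le> inverse (real (Suc n))) sequentially"
    proof (rule eventually_sequentiallyI)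
      fix n assume "Suc m \<le> n"
      then show "norm (f n (x m) - f0 (x m)) \<le> inverse (real (Suc n))"
        using f_near[OF xB[of m n]] by simp
    qed
    then have "(\<lambda>n. f n (x m) - f0 (x m)) \<longlonglongrightarrow> 0"
      using inv0 by (rule Lim_null_comparison)
    then show ?thesis
      by (rule LIM_zero_cancel)
  qed
  have "eventually (\<lambda>n. f n \<in> K) sequentially"
    using fK by simp
  then obtain h where h: "h \<in> K"
    and cl: "\<And>U. openin (Cp X) U \<Longrightarrow> h \<in> U \<Longrightarrow> frequently (\<lambda>n. f n \<in> U) sequentially"
    using compactin_cluster_point[OF K sequentially_bot, of f] by blast
  have h_eq: "h y = l" if "y \<in> topspace X" "(\<lambda>n. f n y) \<longlonglongrightarrow> l" for y l
    by (rule cluster_value_eq_limit[where g = "\<lambda>g. g y" and h = f,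
          OF Cp_eval[OF that(1)] KC(1)[OF h] cl that(2)])
  have hx: "h (x m) = f0 (x m)" for m
    using h_eq[OF _ lim_f] xA AX by blast
  define q where "q n = (case n of 0 \<Rightarrow> f0 | Suc 0 \<Rightarrow> h | Suc (Suc k) \<Rightarrow> f k)" for n
  define p where "p n = (case n of 0 \<Rightarrow> Lim F f0 | Suc 0 \<Rightarrow> Lim F f0 | Suc (Suc k) \<Rightarrow> Lim F (f k))" for n
  have "\<exists>z\<in>topspace X. \<forall>n. q n z = p n"
  proof (rule functionally_bounded_common_value[OF A])
    show "x m \<in> A" for m by (rule xA)
    show "continuous_map X euclideanreal (q n)" for n
      using KC f0 h fK by (auto simp: q_def split: nat.split)
    have l0: "(\<lambda>m. f0 (x m)) \<longlonglongrightarrow> Lim F f0"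
      by (rule lim_x[of _ 0]) (simp add: G0)
    have lk: "(\<lambda>m. f k (x m)) \<longlonglongrightarrow> Lim F (f k)" for k
      by (rule lim_x[of _ "Suc k"]) (simp add: GS)
    show "(\<lambda>m. q n (x m)) \<longlonglongrightarrow> p n" for n
      using l0 lk by (auto simp: q_def p_def hx split: nat.split)
  qed
  then obtain z where z: "z \<in> topspace X" "\<And>n. q n z = p n" by blast
  have "h z = Lim F f0" "f k z = Lim F (f k)" for k
    using z(2)[of "Suc 0"] z(2)[of "Suc (Suc k)"] by (simp_all add: q_def p_def)
  note hz = this
  define U where "U = {g \<in> topspace (Cp X). g z \<in> ball (h z) \<epsilon>}"
  have "openin (Cp X) U"
    unfolding U_def by (intro openin_continuous_map_preimage[OF Cp_eval[OF z(1)]]) simp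
  from cl[OF this] have "frequently (\<lambda>n. f n \<in> U) sequentially"
    using KC(1)[OF h] \<epsilon> by (simp add: U_def)
  then obtain n where "f n \<in> U"
    by (auto dest: frequently_ex)
  then have "dist (h z) (f n z) < \<epsilon>"
    by (simp add: U_def)
  then show False
    using f_far[of n] hz(1) hz(2)[of n] by (simp add: dist_commute)
qed

lemma compactin_closure_of:
  assumes "Hausdorff_space X" "compactin X K" "A \<subseteq> K"
  shows "compactin X (X closure_of A)"
  by (rule closed_compactin[OF assms(2) closure_of_minimal[OF assms(3) compactin_imp_closedin[OF assms(1,2)]]
        closedin_closure_of])

text \<open>The closure of a functionally bounded set \<open>A\<close> is compact: the evaluation map \<open>e\<close> carries \<open>A\<close> into a
  product of compact intervals, the closure \<open>P\<close> of the image consists of images of points of the space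
  by \<open>\<kappa>\<close>-completeness, and the inverse \<open>g\<close> of \<open>e\<close> is continuous on \<open>P\<close>.\<close>

lemma kappa_complete_imp_mu:
  fixes X :: "'a topology"
  assumes T: "Tychonoff_space X" and X: "kappa_complete X"
  shows "mu_space X"
  unfolding mu_space_def
proof (intro conjI allI impI T)
  fix A assume A: "functionally_bounded_in X A"
  have AX: "A \<subseteq> topspace X"
    using A by (simp add: functionally_bounded_in_def)
  have cr: "completely_regular_space X" and H: "Hausdorff_space X"
    using T by (simp_all add: Tychonoff_space_def)
  define I where "I = topspace (Cp X)"
  define e where "e x = restrict (\<lambda>f. f x) I" for x :: 'a
  have "\<exists>b. \<forall>x\<in>A. \<bar>f x\<bar> \<le> b" if "f \<in> I" for f
    using A that by (auto simp: I_def topspace_Cp functionally_bounded_in_def bounded_iff)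
  then obtain b where b: "\<And>f x. f \<in> I \<Longrightarrow> x \<in> A \<Longrightarrow> \<bar>f x\<bar> \<le> b f"
    by metis
  define P where "P = powertop_real I closure_of (e ` A)"
  have "compactin (powertop_real I) (PiE I (\<lambda>f. {- b f .. b f}))"
    by (simp add: compactin_PiE)
  moreover have "e ` A \<subseteq> PiE I (\<lambda>f. {- b f .. b f})"
    using b by (fastforce simp: e_def abs_le_iff)
  moreover have "Hausdorff_space (powertop_real I)"
    by (simp add: Hausdorff_space_product_topology)
  ultimately have P: "compactin (powertop_real I) P"
    unfolding P_def by (intro compactin_closure_of)
  have "\<exists>l\<in>topspace X. e l = \<phi>" if \<phi>: "\<phi> \<in> P" for \<phi>
  proof -
    obtain F where F: "F \<noteq> bot" "eventually (\<lambda>x. x \<in> A) F" "limitin (powertop_real I) e \<phi> F"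
      using \<phi> unfolding P_def by (rule exists_filter_closure)
    have evX: "eventually (\<lambda>x. x \<in> topspace X) F"
      using F(2) AX by (auto elim: eventually_mono)
    have lim': "(f \<longlongrightarrow> \<phi> f) F" if "f \<in> I" for f
      using F(3) that by (simp add: limitin_componentwise e_def)
    have lim: "(f \<longlongrightarrow> Lim F f) F" if f: "continuous_map X euclideanreal f" for f
    proof -
      have "restrict f (topspace X) \<in> I"
        unfolding I_def by (rule restrict_in_Cp[OF f])
      from lim'[OF this] have "(restrict f (topspace X) \<longlongrightarrow> \<phi> (restrict f (topspace X))) F" .
      moreover have "eventually (\<lambda>x. restrict f (topspace X) x = f x) F"
        using evX by eventually_elim simp
      ultimately have "(f \<longlongrightarrow> \<phi> (restrict f (topspace X))) F"
        by (simp add: tendsto_cong)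
      then show ?thesis
        using F(1) by (simp add: tendsto_Lim)
    qed
    have "kappa_Cauchy X F"
      unfolding kappa_Cauchy_def
      by (intro conjI allI impI F(1) evX lim functionally_bounded_Lim_continuous[OF A F(1,2) lim])
    then obtain l where l: "limitin X (\<lambda>x. x) l F"
      using X by (auto simp: kappa_complete_def)
    have "e l = \<phi>"
    proof (rule extensionalityI[of _ I])
      show "\<phi> \<in> extensional I"
        using F(3) by (simp add: limitin_componentwise)
      fix f assume f: "f \<in> I"
      then have "continuous_map X euclideanreal f"
        by (simp add: I_def topspace_Cp)
      from continuous_map_limit[OF this l] have "(f \<longlongrightarrow> f l) F"
        by (simp add: o_def)
      then show "e l f = \<phi> f"
        using tendsto_unique[OF F(1) _ lim'[OF f]] f by (simp add: e_def)
    qed (simp add: e_def)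
    then show ?thesis
      using limitin_topspace[OF l] by blast
  qed
  then obtain g where g: "\<And>\<phi>. \<phi> \<in> P \<Longrightarrow> g \<phi> \<in> topspace X" "\<And>\<phi>. \<phi> \<in> P \<Longrightarrow> e (g \<phi>) = \<phi>"
    by metis
  have gc: "continuous_map (subtopology (powertop_real I) P) X g"
  proof (rule continuous_map_into_completely_regular[OF cr])
    fix f assume f: "f \<in> topspace (Cp X)"
    have "continuous_map (subtopology (powertop_real I) P) euclideanreal (\<lambda>\<phi>. \<phi> f)"
      using f by (intro continuous_map_from_subtopology continuous_map_product_projection) (simp add: I_def)
    then show "continuous_map (subtopology (powertop_real I) P) euclideanreal (\<lambda>\<phi>. f (g \<phi>))"
    proof (rule continuous_map_eq)
      fix \<phi> assume "\<phi> \<in> topspace (subtopology (powertop_real I) P)"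
      then show "\<phi> f = f (g \<phi>)"
        using fun_cong[OF g(2)[of \<phi>], of f] f by (simp add: e_def I_def)
    qed
  qed (use g in auto)
  have "compactin X (g ` P)"
    using image_compactin[OF _ gc] P by (simp add: compactin_subtopology)
  moreover have "A \<subseteq> g ` P"
  proof
    fix x assume x: "x \<in> A"
    have "e x \<in> P"
      unfolding P_def using x b by (intro closure_of_subset[THEN subsetD]) (auto simp: e_def)
    moreover from g[OF this] have "g (e x) = x"
    proof -
      assume gx: "g (e x) \<in> topspace X" "e (g (e x)) = e x"
      show ?thesis
      proof (rule Cp_separates_points[OF T gx(1)])
        fix f assume "f \<in> topspace (Cp X)"
        then show "f (g (e x)) = f x"
          using fun_cong[OF gx(2), of f] by (simp add: e_def I_def)
      qed (use x AX in auto)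
    qed
    ultimately show "x \<in> g ` P" by force
  qed
  ultimately show "compactin X (X closure_of A)"
    using H by (intro compactin_closure_of)
qed

lemma pseudocompact_mu_imp_compact:
  assumes "pseudocompact_space X" "mu_space X"
  shows "compact_space X"
proof -
  have "functionally_bounded_in X (topspace X)"
    using assms(1) by (auto simp: functionally_bounded_in_def pseudocompact_space_def)
  then have "compactin X (X closure_of topspace X)"
    using assms(2) unfolding mu_space_def by blast
  then show ?thesis
    by (simp add: compact_space_def)
qed

lemma pseudocompact_kappa_iff_compact:
  assumes X: "pseudocompact_space X"
  shows "kappa_space X \<longleftrightarrow> compact_space X"
proof
  assume "kappa_space X"
  then have "mu_space X"
    by (simp add: kappa_space_iff kappa_complete_imp_mu)
  with X show "compact_space X"
    by (rule pseudocompact_mu_imp_compact)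
next
  assume "compact_space X"
  with X show "kappa_space X"
    by (simp add: kappa_space_iff kappa_complete_compact pseudocompact_space_def)
qed

section \<open>The order topology of a well-ordering\<close>

context
  fixes r :: "'a rel"
  assumes wo: "Well_order r"
begin

lemma order_topology_refl: "a \<in> Field r \<Longrightarrow> (a, a) \<in> r"
  using wo by (auto simp: well_order_on_def linear_order_on_def partial_order_on_def preorder_on_def refl_on_def)

lemma order_topology_trans: "(a, b) \<in> r \<Longrightarrow> (b, c) \<in> r \<Longrightarrow> (a, c) \<in> r"
  using wo by (auto simp: well_order_on_def linear_order_on_def partial_order_on_def preorder_on_def elim: transE)

lemma order_topology_antisym: "(a, b) \<in> r \<Longrightarrow> (b, a) \<in> r \<Longrightarrow> a = b"
  using wo by (auto simp: well_order_on_def linear_order_on_def partial_order_on_def elim: antisymD)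

lemma order_topology_total: "a \<in> Field r \<Longrightarrow> b \<in> Field r \<Longrightarrow> (a, b) \<in> r \<or> (b, a) \<in> r"
  using wo order_topology_refl[of a]
  by (cases "a = b") (auto simp: well_order_on_def linear_order_on_def total_on_def)

lemma topspace_order_topology_of: "topspace (order_topology_of r) = Field r"
  by (auto simp: order_topology_of_def topology_generated_by_topspace underS_def aboveS_def Field_def)

lemma under_subset_underS:
  assumes "a \<in> underS r b" shows "under r a \<subseteq> underS r b"
proof
  fix c assume "c \<in> under r a"
  then have c: "(c, a) \<in> r" "(a, b) \<in> r" "a \<noteq> b"
    using assms by (auto simp: under_def underS_def)
  then show "c \<in> underS r b"
    using order_topology_trans[of c a b] order_topology_antisym[of a b] by (auto simp: underS_def)
qed

lemma aboveS_antimono: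
  assumes "(b, c) \<in> r" shows "aboveS r c \<subseteq> aboveS r b"
proof
  fix x assume "x \<in> aboveS r c"
  then have "(c, x) \<in> r" "x \<noteq> c" by (auto simp: aboveS_def)
  then show "x \<in> aboveS r b"
    using assms order_topology_trans[of b c x] order_topology_antisym[of b c] by (auto simp: aboveS_def)
qed

lemma openin_order_topology_underS: "a \<in> Field r \<Longrightarrow> openin (order_topology_of r) (underS r a)"
  and openin_order_topology_aboveS: "a \<in> Field r \<Longrightarrow> openin (order_topology_of r) (aboveS r a)"
  unfolding order_topology_of_def by (rule topology_generated_by_Basis; blast)+

text \<open>A closed initial segment is open: it is the whole space, or the open initial segment below the successor.\<close>

lemma openin_order_topology_under:
  assumes a: "a \<in> Field r" shows "openin (order_topology_of r) (under r a)"
proof (cases "aboveS r a = {}")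
  case True
  have "under r a = Field r"
  proof
    show "under r a \<subseteq> Field r" by (auto simp: under_def Field_def)
    show "Field r \<subseteq> under r a"
    proof
      fix b assume b: "b \<in> Field r"
      then show "b \<in> under r a"
        using True order_topology_total[OF a b] order_topology_refl[OF b]
        by (auto simp: under_def aboveS_def)
    qed
  qed
  then show ?thesis
    using openin_topspace[of "order_topology_of r"] by (simp add: topspace_order_topology_of)
next
  case False
  have wf: "wf (r - Id)"
    using wo by (simp add: well_order_on_def)
  obtain b where b: "b \<in> aboveS r a" "\<And>c. (c, b) \<in> r - Id \<Longrightarrow> c \<notin> aboveS r a"
    using wfE_min'[OF wf False] by blast
  have bF: "b \<in> Field r" using b(1) by (auto simp: aboveS_def Field_def)
  have "under r a = underS r b"
  proof
    show "under r a \<subseteq> underS r b"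
      using b(1) by (intro under_subset_underS) (auto simp: aboveS_def underS_def)
    show "underS r b \<subseteq> under r a"
    proof
      fix c assume "c \<in> underS r b"
      then have c: "(c, b) \<in> r" "c \<noteq> b" by (auto simp: underS_def)
      then have "c \<in> Field r" by (auto simp: Field_def)
      then show "c \<in> under r a"
        using b(2)[of c] c order_topology_total[OF a, of c] order_topology_refl[OF a]
        by (auto simp: under_def aboveS_def)
    qed
  qed
  then show ?thesis
    using openin_order_topology_underS[OF bF] by simp
qed

text \<open>A neighbourhood of \<^term>\<open>a\<close> contains an interval \<open>(b, a]\<close>, or all of \<open>[0, a]\<close>; the latter happens in
  particular when \<^term>\<open>a\<close> is the least element.\<close>

lemma order_topology_nbhd:
  assumes "openin (order_topology_of r) U" "a \<in> U"
  shows "under r a \<subseteq> U \<or> (\<exists>b\<in>underS r a. aboveS r b \<inter> under r a \<subseteq> U)"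
proof -
  have "generate_topology_on ({Field r} \<union> {underS r a | a. a \<in> Field r} \<union> {aboveS r a | a. a \<in> Field r}) U"
    using assms(1) by (simp add: order_topology_of_def openin_topology_generated_by_iff)
  then show ?thesis
    using assms(2)
  proof (induction U)
    case Empty
    then show ?case by simp
  next
    case (Int U V)
    show ?case
    proof (cases "under r a \<subseteq> U \<or> under r a \<subseteq> V")
      case True
      then show ?thesis using Int by blast
    next
      case False
      then obtain b c where b: "b \<in> underS r a" "aboveS r b \<inter> under r a \<subseteq> U"
        and c: "c \<in> underS r a" "aboveS r c \<inter> under r a \<subseteq> V"
        using Int by blast
      have F: "b \<in> Field r" "c \<in> Field r"
        using b c by (auto simp: underS_def Field_def)
      from order_topology_total[OF this] show ?thesis
      proof
        assume "(b, c) \<in> r"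
        then have "aboveS r c \<subseteq> aboveS r b"
          by (rule aboveS_antimono)
        then show ?thesis using b c by blast
      next
        assume "(c, b) \<in> r"
        then have "aboveS r b \<subseteq> aboveS r c"
          by (rule aboveS_antimono)
        then show ?thesis using b c by blast
      qed
    qed
  next
    case (UN K)
    then obtain k where "k \<in> K" "a \<in> k" by blast
    then show ?case using UN.IH[of k] by blast
  next
    case (Basis s)
    then consider "s = Field r" | c where "s = underS r c" | c where "c \<in> Field r" "s = aboveS r c"
      by blast
    then show ?case
    proof cases
      case 1
      then show ?thesis by (auto simp: under_def Field_def)
    next
      case (2 c)
      have "under r a \<subseteq> s"
        using Basis.prems unfolding 2 by (rule under_subset_underS)
      then show ?thesis ..
    next
      case (3 c)
      then have "c \<in> underS r a"
        using Basis.prems by (auto simp: aboveS_def underS_def)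
      then show ?thesis using 3 by blast
    qed
  qed
qed

lemma compactin_order_topology_under:
  assumes "a \<in> Field r"
  shows "compactin (order_topology_of r) (under r a)"
proof -
  have wf: "wf (r - Id)"
    using wo by (simp add: well_order_on_def)
  \<comment> \<open>a member of a cover that contains \<open>a\<close> covers some \<open>(b, a]\<close>, and \<open>[0, b]\<close> is compact by induction\<close>
  from wf assms show ?thesis
  proof (induction a)
    case (less a)
    show ?case
      unfolding compactin_def
    proof (intro conjI allI impI; (elim conjE)?)
      show "under r a \<subseteq> topspace (order_topology_of r)"
        by (auto simp: topspace_order_topology_of under_def Field_def)
      fix \<U> assume op: "Ball \<U> (openin (order_topology_of r))" and cov: "under r a \<subseteq> \<Union>\<U>"
      have "a \<in> under r a" using order_topology_refl[OF less.prems] by (simp add: under_def)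
      then obtain U where U: "U \<in> \<U>" "a \<in> U" using cov by blast
      then have "openin (order_topology_of r) U" using op by blast
      from order_topology_nbhd[OF this U(2)]
      show "\<exists>\<F>. finite \<F> \<and> \<F> \<subseteq> \<U> \<and> under r a \<subseteq> \<Union>\<F>"
      proof
        assume "under r a \<subseteq> U"
        then show ?thesis using U by (intro exI[of _ "{U}"]) auto
      next
        assume "\<exists>b\<in>underS r a. aboveS r b \<inter> under r a \<subseteq> U"
        then obtain b where b: "b \<in> underS r a" "aboveS r b \<inter> under r a \<subseteq> U" by blast
        have bF: "b \<in> Field r" using b by (auto simp: underS_def Field_def)
        have "compactin (order_topology_of r) (under r b)"
          using less.IH[of b] b bF by (auto simp: underS_def)
        moreover have "under r b \<subseteq> \<Union>\<U>"
          using cov under_subset_underS[OF b(1)] by (auto simp: under_def underS_def)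
        ultimately obtain \<F> where F: "finite \<F>" "\<F> \<subseteq> \<U>" "under r b \<subseteq> \<Union>\<F>"
          using op unfolding compactin_def by meson
        have "under r a \<subseteq> under r b \<union> U"
        proof
          fix c assume c: "c \<in> under r a"
          then have "c \<in> Field r" by (auto simp: under_def Field_def)
          from order_topology_total[OF this bF] order_topology_refl[OF bF]
          have "c \<in> under r b \<or> c \<in> aboveS r b"
            by (auto simp: under_def aboveS_def)
          then show "c \<in> under r b \<union> U" using b c by blast
        qed
        then show ?thesis
          using F U by (intro exI[of _ "insert U \<F>"]) auto
      qed
    qed
  qed
qed

lemma Hausdorff_space_order_topology: "Hausdorff_space (order_topology_of r)"
proof -
  have sep: "\<exists>U V. openin (order_topology_of r) U \<and> openin (order_topology_of r) V \<and> a \<in> U \<and> b \<in> V \<and> disjnt U V"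
    if ab: "a \<in> Field r" "b \<in> Field r" "(a, b) \<in> r" "a \<noteq> b" for a b
  proof (intro exI conjI)
    show "openin (order_topology_of r) (under r a)" "openin (order_topology_of r) (aboveS r a)"
      using ab openin_order_topology_under openin_order_topology_aboveS by auto
    show "a \<in> under r a" "b \<in> aboveS r a"
      using ab order_topology_refl by (auto simp: under_def aboveS_def)
    show "disjnt (under r a) (aboveS r a)"
      unfolding disjnt_def under_def aboveS_def using order_topology_antisym by blast
  qed
  show ?thesis
    unfolding Hausdorff_space_def topspace_order_topology_of
  proof (intro allI impI, elim conjE)
    fix a b assume ab: "a \<in> Field r" "b \<in> Field r" "a \<noteq> b"
    from order_topology_total[OF ab(1,2)]
    show "\<exists>U V. openin (order_topology_of r) U \<and> openin (order_topology_of r) V \<and> a \<in> U \<and> b \<in> V \<and> disjnt U V"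
    proof
      assume "(a, b) \<in> r"
      then show ?thesis using sep ab by blast
    next
      assume "(b, a) \<in> r"
      then obtain U V where "openin (order_topology_of r) U" "openin (order_topology_of r) V"
        "b \<in> U" "a \<in> V" "disjnt U V"
        using sep[of b a] ab by blast
      then show ?thesis by (intro exI[of _ V] exI[of _ U]) (auto simp: disjnt_sym)
    qed
  qed
qed

lemma Tychonoff_space_order_topology: "Tychonoff_space (order_topology_of r)"
proof -
  have "locally_compact_space (order_topology_of r)"
    unfolding locally_compact_space_def topspace_order_topology_of
  proof
    fix a assume a: "a \<in> Field r"
    then have "a \<in> under r a"
      using order_topology_refl by (simp add: under_def)
    then show "\<exists>U K. openin (order_topology_of r) U \<and> compactin (order_topology_of r) K \<and> a \<in> U \<and> U \<subseteq> K"
      using openin_order_topology_under[OF a] compactin_order_topology_under[OF a] by blast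
  qed
  then show ?thesis
    using Hausdorff_space_order_topology
    by (simp add: Tychonoff_space_def completely_regular_eq_regular_space
        locally_compact_Hausdorff_imp_regular_space)
qed

lemma first_countable_order_topology:
  assumes "\<And>a. countable (underS r a)"
  shows "first_countable (order_topology_of r)"
  unfolding first_countable_def topspace_order_topology_of
proof
  fix a assume a: "a \<in> Field r"
  have uF: "b \<in> Field r" if "b \<in> underS r a" for b
    using that by (auto simp: underS_def Field_def)
  have au: "a \<in> under r a"
    using order_topology_refl[OF a] by (simp add: under_def)
  define \<B> where "\<B> = insert (under r a) ((\<lambda>b. aboveS r b \<inter> under r a) ` underS r a)"
  have "countable \<B>"
    using assms by (simp add: \<B>_def)
  moreover have "\<forall>V\<in>\<B>. openin (order_topology_of r) V"
    using openin_order_topology_under[OF a] openin_order_topology_aboveS uF by (auto simp: \<B>_def)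
  moreover have "\<exists>V\<in>\<B>. a \<in> V \<and> V \<subseteq> U" if "openin (order_topology_of r) U" "a \<in> U" for U
    using order_topology_nbhd[OF that]
  proof
    assume "under r a \<subseteq> U"
    then show ?thesis using au by (auto simp: \<B>_def)
  next
    assume "\<exists>b\<in>underS r a. aboveS r b \<inter> under r a \<subseteq> U"
    then obtain b where b: "b \<in> underS r a" "aboveS r b \<inter> under r a \<subseteq> U" by blast
    then have "a \<in> aboveS r b" by (auto simp: aboveS_def underS_def)
    then show ?thesis using b au by (auto simp: \<B>_def)
  qed
  ultimately show "\<exists>\<B>. countable \<B> \<and> (\<forall>V\<in>\<B>. openin (order_topology_of r) V) \<and>
      (\<forall>U. openin (order_topology_of r) U \<and> a \<in> U \<longrightarrow> (\<exists>V\<in>\<B>. a \<in> V \<and> V \<subseteq> U))"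
    by (intro exI[of _ \<B>] conjI allI impI) simp_all
qed

lemma countable_subset_bounded:
  assumes ctb: "\<And>a. countable (underS r a)" and unc: "uncountable (Field r)"
    and C: "countable C" "C \<subseteq> Field r"
  obtains a where "a \<in> Field r" "C \<subseteq> under r a"
proof -
  have un: "under r b \<subseteq> insert b (underS r b)" for b
    by (auto simp: under_def underS_def)
  have "countable (under r b)" for b
    by (rule countable_subset[OF un]) (simp add: ctb)
  then have "countable (\<Union>b\<in>C. under r b)"
    using C(1) by simp
  then have "\<not> Field r \<subseteq> (\<Union>b\<in>C. under r b)"
    using unc countable_subset[of "Field r"] by metis
  then obtain a where a: "a \<in> Field r" "a \<notin> (\<Union>b\<in>C. under r b)"
    by blast
  have "C \<subseteq> under r a"
  proof
    fix b assume b: "b \<in> C"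
    then have "(a, b) \<notin> r" using a by (auto simp: under_def)
    then show "b \<in> under r a"
      using order_topology_total[OF a(1), of b] b C(2) by (auto simp: under_def)
  qed
  with a(1) show thesis by (rule that)
qed

lemma pseudocompact_space_order_topology:
  assumes ctb: "\<And>a. countable (underS r a)" and unc: "uncountable (Field r)"
  shows "pseudocompact_space (order_topology_of r)"
  unfolding pseudocompact_space_def
proof (intro conjI allI impI Tychonoff_space_order_topology, rule ccontr)
  fix f :: "'a \<Rightarrow> real"
  assume f: "continuous_map (order_topology_of r) euclideanreal f"
    and unb: "\<not> bounded (f ` topspace (order_topology_of r))"
  have "\<exists>x\<in>Field r. real n < \<bar>f x\<bar>" for n :: nat
    using unb by (force simp: bounded_iff topspace_order_topology_of not_le)
  then obtain x where x: "\<And>n. x n \<in> Field r" "\<And>n. real n < \<bar>f (x n)\<bar>"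
    by metis
  obtain a where a: "a \<in> Field r" "range x \<subseteq> under r a"
    by (rule countable_subset_bounded[OF ctb unc, of "range x"]) (use x in auto)
  have "compactin euclideanreal (f ` under r a)"
    using image_compactin[OF compactin_order_topology_under[OF a(1)] f] .
  then have "bounded (f ` under r a)"
    by (simp add: compact_imp_bounded)
  then obtain B where B: "\<And>y. y \<in> under r a \<Longrightarrow> \<bar>f y\<bar> \<le> B"
    by (auto simp: bounded_iff)
  obtain n where "B < real n"
    using reals_Archimedean2 by blast
  then show False
    using x(2)[of n] B[of "x n"] a(2) by auto
qed

lemma not_compact_space_order_topology:
  assumes ctb: "\<And>a. countable (underS r a)" and unc: "uncountable (Field r)"
  shows "\<not> compact_space (order_topology_of r)"
proof
  assume "compact_space (order_topology_of r)"
  then have c: "compactin (order_topology_of r) (Field r)"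
    by (simp add: compact_space_def topspace_order_topology_of)
  have "Field r \<subseteq> \<Union>(under r ` Field r)"
    using order_topology_refl by (auto simp: under_def)
  then obtain \<F> where F: "finite \<F>" "\<F> \<subseteq> under r ` Field r" "Field r \<subseteq> \<Union>\<F>"
    using compactinD[OF c, of "under r ` Field r"] openin_order_topology_under by auto
  have un: "under r b \<subseteq> insert b (underS r b)" for b
    by (auto simp: under_def underS_def)
  have "countable (under r b)" for b
    by (rule countable_subset[OF un]) (simp add: ctb)
  then have "countable (\<Union>V\<in>\<F>. V)"
    using F(1,2) by (intro countable_UN[OF countable_finite]) auto
  then show False
    using F(3) unc countable_subset[of "Field r" "\<Union>\<F>"] by simp
qed

end

section \<open>Properties of kappa-spaces\<close>

theorem proposition3p3:
  shows
    "(\<forall>(I :: 'i set) (X :: 'i \<Rightarrow> 'a topology).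
        (\<forall>i\<in>I. kappa_space (X i)) \<longrightarrow> kappa_space (product_topology X I)) \<and>
     (\<forall>(X :: 'b topology) C.
        kappa_space X \<and> closedin X C \<longrightarrow> kappa_space (subtopology X C)) \<and>
     (\<forall>X :: 'c topology. realcompact_space X \<longrightarrow> kappa_space X) \<and>
     (\<forall>(X :: 'd topology) \<M>.
        Tychonoff_space X \<and> \<M> \<noteq> {} \<and>
        (\<forall>S\<in>\<M>. S \<subseteq> topspace X \<and> kappa_space (subtopology X S)) \<longrightarrow>
        kappa_space (subtopology X (\<Inter>\<M>))) \<and>
     (\<forall>(X :: 'e topology) (Y :: 'f topology) f.
        Tychonoff_space X \<and> Tychonoff_space Y \<and>
        continuous_map X Y f \<and> closed_map X Y f \<and>
        (\<forall>y\<in>topspace Y. compactin X {x \<in> topspace X. f x = y}) \<and>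
        kappa_space Y \<longrightarrow> kappa_space X) \<and>
     (\<forall>X :: 'g topology. Tychonoff_space X \<and> kR_space (Cp X) \<longrightarrow> kappa_space X) \<and>
     (\<forall>X :: 'h topology. kappa_space X \<longrightarrow> mu_space X) \<and>
     (\<forall>X :: 'j topology. metrizable_space X \<longrightarrow> kappa_space X) \<and>
     (\<forall>X :: 'k topology. Dieudonne_complete_space X \<longrightarrow> kappa_space X) \<and>
     ((\<forall>X :: 'l topology. pseudocompact_space X \<longrightarrow> (kappa_space X \<longleftrightarrow> compact_space X)) \<and>
      first_countable omega1 \<and> pseudocompact_space omega1 \<and> \<not> kappa_space omega1) \<and>
     (\<forall>X :: 'm topology. kR_space X \<longrightarrow> kappa_space (Cp X))"
proof (intro conjI allI impI; (elim conjE)?)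
  fix I :: "'i set" and X :: "'i \<Rightarrow> 'a topology"
  assume "\<forall>i\<in>I. kappa_space (X i)"
  then show "kappa_space (product_topology X I)"
    by (simp add: kappa_space_iff Tychonoff_space_product_topology kappa_complete_product_topology)
next
  fix X :: "'b topology" and C
  assume "kappa_space X" "closedin X C"
  then show "kappa_space (subtopology X C)"
    by (simp add: kappa_space_iff Tychonoff_space_subtopology kappa_complete_closed_subtopology)
next
  fix X :: "'c topology"
  assume "realcompact_space X"
  then show "kappa_space X"
    by (rule realcompact_imp_kappa_space)
next
  fix X :: "'d topology" and \<M>
  assume "Tychonoff_space X" "\<M> \<noteq> {}"
    "\<forall>S\<in>\<M>. S \<subseteq> topspace X \<and> kappa_space (subtopology X S)"
  then show "kappa_space (subtopology X (\<Inter>\<M>))"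
    by (simp add: kappa_space_iff Tychonoff_space_subtopology kappa_complete_Inter
        Tychonoff_imp_Hausdorff_space)
next
  fix X :: "'e topology" and Y :: "'f topology" and f
  assume "Tychonoff_space X" "kappa_space Y" "continuous_map X Y f" "closed_map X Y f"
    "\<forall>y\<in>topspace Y. compactin X {x \<in> topspace X. f x = y}"
  then show "kappa_space X"
    using kappa_complete_perfect[of X Y f] by (simp add: kappa_space_iff Tychonoff_imp_completely_regular_space)
next
  fix X :: "'g topology"
  assume "Tychonoff_space X" "kR_space (Cp X)"
  then show "kappa_space X"
    by (simp add: kappa_space_iff kappa_complete_if_kR_Cp)
next
  fix X :: "'h topology"
  assume "kappa_space X"
  then show "mu_space X"
    by (simp add: kappa_space_iff kappa_complete_imp_mu)
next
  fix X :: "'j topology"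
  assume "metrizable_space X"
  then show "kappa_space X"
    by (simp add: kappa_space_iff metrizable_imp_Tychonoff_space kappa_complete_metrizable)
next
  fix X :: "'k topology"
  assume "Dieudonne_complete_space X"
  then show "kappa_space X"
    by (simp add: kappa_space_iff kappa_complete_Dieudonne) (simp add: Dieudonne_complete_space_def)
next
  fix X :: "'l topology"
  assume "pseudocompact_space X"
  then show "kappa_space X \<longleftrightarrow> compact_space X"
    by (rule pseudocompact_kappa_iff_compact)
next
  show "first_countable omega1"
    unfolding omega1_def by (intro first_countable_order_topology omega1_order)
  show pseudo: "pseudocompact_space omega1"
    unfolding omega1_def by (intro pseudocompact_space_order_topology omega1_order)
  have "\<not> compact_space omega1"
    unfolding omega1_def by (intro not_compact_space_order_topology omega1_order)
  with pseudo show "\<not> kappa_space omega1"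
    by (simp add: pseudocompact_kappa_iff_compact)
next
  fix X :: "'m topology"
  assume X: "kR_space X"
  have "kappa_complete (Cp X)"
    by (rule kappa_complete_Cp) (use X in \<open>auto simp: kR_space_def\<close>)
  then show "kappa_space (Cp X)"
    by (simp add: kappa_space_iff Tychonoff_space_Cp)
qed

end
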